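(* Every locally connected non-metrizable sequential rectifiable regular topological space $X$ of countable $\mathrm{cs}^*$-character is homeomorphic to the product $H\times D$ of a connected $sk_\omega$-space $H$ and a discrete space $D$.
   Context: All topological spaces are assumed to be regular (including the $T_1$ axiom). A topological space $X$ is rectifiable if there exist a point $e\in X$ and a homeomorphism $h:X\times X\to X\times X$ such that $h(x,e)=(x,x)$ and $h(\{x\}\times X)\subset\{x\}\times X$ for every $x\in X$. A family $\mathcal N$ of subsets of $X$ is a $\mathrm{cs}^*$-network at a point $x\in X$ if for each neighborhood $O_x$ of $x$ and each sequence $(x_n)_{n\in\omega}$ in $X$ converging to $x$ there is $N\in\mathcal N$ such that $x\in N\subset O_x$ and $x_n\in N$ for infinitely many $n$. The space $X$ has countable $\mathrm{cs}^*$-character if at each point $x\in X$ it has a countable $\mathrm{cs}^*$-network. A space $X$ is sequential if for each non-closed subset $A\subset X$ there is a sequence in $A$ that converges in $X$ to a point $x\notin A$. A space $X$ is an $sk_\omega$-space if there is a countable cover $\mathcal K$ of $X$ by compact metrizable subspaces such that a set $A\subset X$ is closed in $X$ if and only if $A\cap K$ is closed in $K$ for every $K\in\mathcal K$. *)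

theory Defs
  imports "HOL-Analysis.Analysis"
begin

definition rectifiable_space :: "'a topology \<Rightarrow> bool" where
  "rectifiable_space X \<longleftrightarrow>
     (\<exists>e \<in> topspace X. \<exists>h.
        homeomorphic_map (prod_topology X X) (prod_topology X X) h \<and>
        (\<forall>x \<in> topspace X. h (x, e) = (x, x) \<and>
           h ` ({x} \<times> topspace X) \<subseteq> {x} \<times> topspace X))"

(* Neighbourhoods of x are not required to be open. *)
definition cs_star_network_at :: "'a topology \<Rightarrow> 'a \<Rightarrow> 'a set set \<Rightarrow> bool" where
  "cs_star_network_at X x \<N> \<longleftrightarrow>
     (\<forall>N \<in> \<N>. N \<subseteq> topspace X) \<and>
     (\<forall>V s. V \<subseteq> topspace X \<and> (\<exists>U. openin X U \<and> x \<in> U \<and> U \<subseteq> V) \<and>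
        range s \<subseteq> topspace X \<and> limitin X s x sequentially \<longrightarrow>
        (\<exists>N \<in> \<N>. x \<in> N \<and> N \<subseteq> V \<and> infinite {n::nat. s n \<in> N}))"

definition countable_cs_star_character :: "'a topology \<Rightarrow> bool" where
  "countable_cs_star_character X \<longleftrightarrow>
     (\<forall>x \<in> topspace X. \<exists>\<N>. countable \<N> \<and> cs_star_network_at X x \<N>)"

definition sequential_space :: "'a topology \<Rightarrow> bool" where
  "sequential_space X \<longleftrightarrow>
     (\<forall>A. A \<subseteq> topspace X \<and> \<not> closedin X A \<longrightarrow>
        (\<exists>(s :: nat \<Rightarrow> 'a) x. range s \<subseteq> A \<and> x \<notin> A \<and> limitin X s x sequentially))"

(* The first two conjuncts are the standing assumption that all spaces are regular and T1;
   note that regular_space by itself does not include T1. *)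
definition sk_omega_space :: "'a topology \<Rightarrow> bool" where
  "sk_omega_space X \<longleftrightarrow>
     regular_space X \<and> t1_space X \<and>
     (\<exists>\<K>. countable \<K> \<and> \<Union>\<K> = topspace X \<and>
        (\<forall>K \<in> \<K>. compactin X K \<and> metrizable_space (subtopology X K)) \<and>
        (\<forall>A. A \<subseteq> topspace X \<longrightarrow>
           (closedin X A \<longleftrightarrow> (\<forall>K \<in> \<K>. closedin (subtopology X K) (A \<inter> K)))))"

end

(*
  Normalise the rectification to continuous operations p, q with p x (q x y) = q x (p x y) = y and
  p x e = x, p e y = y.  A countable base at e of sets that eventually contain every sequence
  tending to e consists of neighbourhoods, because the space is sequential; then X is first
  countable and hence metrizable by Frink's criterion.  So in the non-metrizable case there are an
  open neighbourhood U of e and a fan of sequences s_m tending to e, the m-th of which avoids the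
  short p,q-words in those of the first m members N_i of the countable cs*-network that lie in U.
  Consequently no sequence p (q x y) s with x, y in a fixed N_a and s running across the fan
  converges.  If M = N_k Int N_a is such that the p (q x y) s with x, y in M and s in s_k need not
  subconverge, choose such a sequence without limit points; if this were possible for all k for
  which N_k captures a given sequence, the chosen points would form a closed set not containing e
  but with e in its closure.  So countably many M with subconverging perturbations capture all
  sequences tending to e.  The capturing property of the network then gives countably many barriers
  for q M M, which makes e a G_delta point of M, hence of X, and this turns M into a compact
  metrizable set.  Iterated p-products of these sets form a countable family whose union is clopen
  and whose members determine the topology of the union, so the component H of e is an
  sk_omega-space, and (y, d) |-> p d y identifies X with the product of H and a set of
  representatives of the components.
*)
theory Submission
  imports Defs
begin

section \<open>A metrization criterion\<close>

text \<open>A chain construction: the gauge \<open>f\<close> read off from the levels of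
  \<open>E\<close> may fail the triangle inequality, the infimum \<open>d\<close> of the
  \<open>f\<close>-lengths of chains satisfies it, and \<open>comp\<close> bounds how far
  \<open>d\<close> can drop below \<open>f\<close>.\<close>

lemma metrizable_if_uniformity_base:
  fixes X :: "'a topology" and E :: "nat \<Rightarrow> 'a \<Rightarrow> 'a \<Rightarrow> bool"
  assumes refl: "\<And>k x. x \<in> topspace X \<Longrightarrow> E k x x"
    and sym: "\<And>k x y. E k x y \<Longrightarrow> E k y x"
    and mono: "\<And>k x y. E (Suc k) x y \<Longrightarrow> E k x y"
    and comp: "\<And>k x y z w. \<lbrakk>E (Suc k) x y; E (Suc k) y z; E (Suc k) z w\<rbrakk> \<Longrightarrow> E k x w"
    and sep: "\<And>x y. \<lbrakk>x \<in> topspace X; y \<in> topspace X; \<And>k. E k x y\<rbrakk> \<Longrightarrow> x = y"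
    and opn: "\<And>U. openin X U \<longleftrightarrow>
       U \<subseteq> topspace X \<and> (\<forall>x\<in>U. \<exists>k. \<forall>y\<in>topspace X. E k x y \<longrightarrow> y \<in> U)"
  shows "metrizable_space X"
proof -
  \<comment> \<open>The first level that separates \<open>x\<close> from \<open>y\<close> becomes an
    exponent, with 0 if there is none; thus \<open>f x y < (1/2) ^ k\<close> says exactly
    \<open>E k x y\<close>.\<close>
  define f :: "'a \<Rightarrow> 'a \<Rightarrow> real"
    where "f x y = (if \<forall>k. E k x y then 0 else (1/2) ^ (LEAST k. \<not> E k x y))" for x y
  have anti: "E k x y" if "E l x y" "k \<le> l" for k l x y
    using that(2,1) by (induction l rule: dec_induct) (auto intro: mono)
  have f_less: "f x y < (1/2) ^ k \<longleftrightarrow> E k x y" for x y k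
  proof (cases "\<forall>k. E k x y")
    case True
    then show ?thesis by (simp add: f_def)
  next
    case False
    define K where "K = (LEAST k. \<not> E k x y)"
    have nK: "\<not> E K x y"
      unfolding K_def using False LeastI[of "\<lambda>k. \<not> E k x y"] by blast
    have "k < K \<longleftrightarrow> E k x y"
      using nK anti not_less_Least unfolding K_def by (metis linorder_not_less)
    moreover have "(1/2::real) ^ K < (1/2) ^ k \<longleftrightarrow> k < K"
      by (rule power_strict_decreasing_iff) auto
    ultimately show ?thesis using False by (simp add: f_def K_def)
  qed
  have f_nonneg: "0 \<le> f x y" for x y by (simp add: f_def)
  have "E k x y \<longleftrightarrow> E k y x" for k x y using sym by blast
  then have f_sym: "f x y = f y x" for x y by (simp add: f_def)
  define L where "L c n = (\<Sum>i<n. f (c i) (c (Suc i)))" for c :: "nat \<Rightarrow> 'a" and n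
  have L_nonneg: "0 \<le> L c n" for c n
    unfolding L_def by (intro sum_nonneg) (simp add: f_nonneg)
  have L_split: "L c (a + b) = L c a + L (\<lambda>i. c (a + i)) b" for c a b
    unfolding L_def by (induction b) auto
  \<comment> \<open>Induction on the length. One edge is singled out so that the pieces before and
    after it are each shorter than half the bound; both pieces and the edge are then related at
    level \<open>Suc k\<close>, and \<open>comp\<close> joins the three.\<close>
  have chain: "E k (c 0) (c n)" if "\<And>i. i \<le> n \<Longrightarrow> c i \<in> topspace X" "L c n < (1/2) ^ Suc k" for c n k
    using that
  proof (induction n arbitrary: c k rule: less_induct)
    case (less n)
    show ?case
    proof (cases n)
      case 0
      then show ?thesis using less.prems refl by simp
    next
      case (Suc n')
      let ?b = "(1/2::real) ^ Suc (Suc k)"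
      have two: "(1/2::real) ^ Suc k = ?b + ?b" by simp
      \<comment> \<open>\<open>r\<close> is the last place up to which the chain is shorter than
        \<open>?b\<close>; if the whole chain is that short, the last edge is taken and the tail is
        empty.\<close>
      obtain r where r: "r < n" "L c r < ?b" "L (\<lambda>i. c (Suc r + i)) (n - Suc r) < ?b"
      proof (cases "\<exists>r<n. ?b \<le> L c (Suc r)")
        case True
        define r where "r = (LEAST r. ?b \<le> L c (Suc r))"
        have r1: "?b \<le> L c (Suc r)" and "r < n"
          unfolding r_def using True by (auto intro: LeastI le_less_trans[OF Least_le])
        have "L c r < ?b"
        proof (cases r)
          case 0 then show ?thesis by (simp add: L_def)
        next
          case (Suc r')
          then have "r' < (LEAST r. ?b \<le> L c (Suc r))" using r_def by simp
          then show ?thesis using not_less_Least Suc by fastforce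
        qed
        moreover have "L (\<lambda>i. c (Suc r + i)) (n - Suc r) < ?b"
          using L_split[of c "Suc r" "n - Suc r"] \<open>r < n\<close> less.prems(2) r1 two by simp
        ultimately show ?thesis using that \<open>r < n\<close> by blast
      next
        case False
        then have "L c n < ?b" using Suc by force
        moreover have "L c n' \<le> L c n" using Suc f_nonneg by (simp add: L_def)
        ultimately show ?thesis using that[of n'] Suc by (simp add: L_def)
      qed
      have "f (c r) (c (Suc r)) \<le> L c n"
        unfolding L_def using r(1) f_nonneg by (intro member_le_sum) auto
      then have "f (c r) (c (Suc r)) < (1/2) ^ Suc k" using less.prems(2) by linarith
      then have mid: "E (Suc k) (c r) (c (Suc r))" by (simp only: f_less)
      have left: "E (Suc k) (c 0) (c r)"
        using less.IH[OF r(1) _ r(2)] less.prems(1) r(1) by simp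
      have "E (Suc k) (c (Suc r + 0)) (c (Suc r + (n - Suc r)))"
        using less.IH[OF _ _ r(3)] less.prems(1) r(1) by simp
      then have right: "E (Suc k) (c (Suc r)) (c n)" using r(1) by simp
      show ?thesis using comp[OF left mid right] .
    qed
  qed
  define D where "D x y = {L c n | c n. c 0 = x \<and> c n = y \<and> (\<forall>i\<le>n. c i \<in> topspace X)}" for x y
  \<comment> \<open>The default 0 keeps \<open>d\<close> nonnegative and symmetric off the carrier,
    where \<open>D x y\<close> is empty and its infimum says nothing.\<close>
  define d where "d x y = (if x \<in> topspace X \<and> y \<in> topspace X then Inf (D x y) else 0)" for x y
  have bdd: "bdd_below (D x y)" for x y
    unfolding D_def by (rule bdd_belowI[of _ 0]) (auto simp: L_nonneg)
  have edge: "f x y \<in> D x y" if "x \<in> topspace X" "y \<in> topspace X" for x y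
    unfolding D_def
    by (rule CollectI, rule exI[of _ "\<lambda>i. if i = 0 then x else y"], rule exI[of _ 1])
      (auto simp: L_def that)
  have d_le_f: "d x y \<le> f x y" for x y
    using cInf_lower[OF edge bdd] f_nonneg by (auto simp: d_def)
  have d_close: "E k x y"
    if xy: "d x y < (1/2) ^ Suc k" "x \<in> topspace X" "y \<in> topspace X" for k x y
  proof -
    have "Inf (D x y) < (1/2) ^ Suc k" using xy by (simp add: d_def)
    then obtain l where "l \<in> D x y" "l < (1/2) ^ Suc k"
      using cInf_lessD[of "D x y"] edge[OF xy(2,3)] by blast
    then show ?thesis unfolding D_def using chain by blast
  qed
  have D_sym: "D x y \<subseteq> D y x" for x y
  proof
    fix l assume "l \<in> D x y"
    then obtain c n where c: "l = L c n" "c 0 = x" "c n = y" "\<forall>i\<le>n. c i \<in> topspace X"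
      unfolding D_def by blast
    have "L c n = L (\<lambda>i. c (n - i)) n"
      unfolding L_def
      by (rule sum.reindex_bij_witness[of _ "\<lambda>i. n - Suc i" "\<lambda>i. n - Suc i"])
        (auto simp: Suc_diff_Suc f_sym)
    then show "l \<in> D y x"
      unfolding D_def using c by (intro CollectI exI[of _ "\<lambda>i. c (n - i)"] exI[of _ n]) auto
  qed
  interpret d: Metric_space "topspace X" d
  proof
    fix x y z
    have "0 \<le> Inf (D x y)" if "x \<in> topspace X" "y \<in> topspace X" for x y
      using edge[OF that] by (intro cInf_greatest) (auto simp: D_def L_nonneg)
    then show "0 \<le> d x y" by (simp add: d_def)
    have "D x y = D y x" using D_sym by blast
    then show "d x y = d y x" by (simp add: d_def)
    show "d x y = 0 \<longleftrightarrow> x = y" if xy: "x \<in> topspace X" "y \<in> topspace X"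
    proof
      assume "d x y = 0"
      then show "x = y" using sep[OF xy] d_close[OF _ xy] by simp
    next
      assume "x = y"
      moreover have "f x x = 0" using refl xy by (simp add: f_def)
      ultimately show "d x y = 0" using d_le_f[of x x] \<open>0 \<le> d x y\<close> by simp
    qed
    show "d x z \<le> d x y + d y z" if xyz: "x \<in> topspace X" "y \<in> topspace X" "z \<in> topspace X"
    proof -
      have "d x z \<le> a + b" if ab: "a \<in> D x y" "b \<in> D y z" for a b
      proof -
        obtain c n where c: "a = L c n" "c 0 = x" "c n = y" "\<forall>i\<le>n. c i \<in> topspace X"
          using ab(1) unfolding D_def by blast
        obtain c' m where c': "b = L c' m" "c' 0 = y" "c' m = z" "\<forall>i\<le>m. c' i \<in> topspace X"
          using ab(2) unfolding D_def by blast
        define g where "g i = (if i \<le> n then c i else c' (i - n))" for i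
        have "L g n = a" unfolding c L_def g_def by (intro sum.cong) auto
        moreover have "(\<lambda>i. g (n + i)) = c'" using c c' by (auto simp: g_def)
        ultimately have "L g (n + m) = a + b" using L_split[of g n m] c' by simp
        moreover have "g 0 = x" "g (n + m) = z" "\<forall>i\<le>n+m. g i \<in> topspace X"
          using c c' by (auto simp: g_def)
        ultimately have "a + b \<in> D x z" 
          unfolding D_def by (intro CollectI exI[of _ g] exI[of _ "n + m"]) simp
        then show ?thesis using cInf_lower[OF _ bdd] xyz by (simp add: d_def)
      qed
      then have *: "d x z - b \<le> a" if "a \<in> D x y" "b \<in> D y z" for a b
        using that by (simp add: algebra_simps)
      have "d x z - b \<le> d x y" if "b \<in> D y z" for b
        using cInf_greatest[of "D x y" "d x z - b"] edge[OF xyz(1,2)] * that xyz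
        unfolding d_def[of x y] by auto
      then have "d x z - d x y \<le> b" if "b \<in> D y z" for b using that by (simp add: algebra_simps)
      then have "d x z - d x y \<le> d y z"
        using cInf_greatest[of "D y z" "d x z - d x y"] edge[OF xyz(2,3)] xyz
        unfolding d_def[of y z] by auto
      then show ?thesis by simp
    qed
  qed
  \<comment> \<open>Every \<open>E k\<close>-ball contains a metric ball by \<open>d_close\<close>,
    and every metric ball contains an \<open>E k\<close>-ball by \<open>d_le_f\<close>.\<close>
  have "openin X U \<longleftrightarrow> openin d.mtopology U" for U
  proof -
    have "(\<exists>k. \<forall>y\<in>topspace X. E k x y \<longrightarrow> y \<in> U) \<longleftrightarrow> (\<exists>r>0. d.mball x r \<subseteq> U)"
      if x: "x \<in> topspace X" for x
    proof
      assume "\<exists>k. \<forall>y\<in>topspace X. E k x y \<longrightarrow> y \<in> U"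
      then obtain k where k: "\<forall>y\<in>topspace X. E k x y \<longrightarrow> y \<in> U" by blast
      have "d.mball x ((1/2) ^ Suc k) \<subseteq> U"
        using k d_close x by (metis d.in_mball subsetI)
      then show "\<exists>r>0. d.mball x r \<subseteq> U" by (intro exI[of _ "(1/2) ^ Suc k"]) simp
    next
      assume "\<exists>r>0. d.mball x r \<subseteq> U"
      then obtain r where "r > 0" and r: "d.mball x r \<subseteq> U" by blast
      then obtain k where k: "(1/2::real) ^ k < r" using real_arch_pow_inv[of r "1/2"] by auto
      have "y \<in> U" if "y \<in> topspace X" "E k x y" for y
        using r x that d_le_f[of x y] k f_less[of x y k] by (auto simp: subset_iff)
      then show "\<exists>k. \<forall>y\<in>topspace X. E k x y \<longrightarrow> y \<in> U" by blast
    qed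
    then show ?thesis unfolding opn d.openin_mtopology by blast
  qed
  then have "X = d.mtopology" by (simp add: topology_eq)
  then show ?thesis using d.metrizable_space_mtopology by simp
qed

text \<open>Frink's criterion: passing from the basis \<open>V n x\<close> to \<open>V (\<nu> k x) x\<close>, where \<open>\<nu> (k + 1) x\<close>
  is provided by the star condition at \<open>\<nu> k x\<close>, makes two members of the \<open>(k + 1)\<close>st cover that
  meet lie in a common member of the \<open>k\<close>th one.\<close>

lemma metrizable_if_local_star_base:
  fixes X :: "'a topology" and V :: "nat \<Rightarrow> 'a \<Rightarrow> 'a set"
  assumes t1: "t1_space X"
    and opn: "\<And>n x. x \<in> topspace X \<Longrightarrow> openin X (V n x)"
    and mem: "\<And>n x. x \<in> topspace X \<Longrightarrow> x \<in> V n x"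
    and dec: "\<And>n x. x \<in> topspace X \<Longrightarrow> V (Suc n) x \<subseteq> V n x"
    and base: "\<And>U x. \<lbrakk>openin X U; x \<in> U\<rbrakk> \<Longrightarrow> \<exists>n. V n x \<subseteq> U"
    and star: "\<And>x n. x \<in> topspace X \<Longrightarrow>
       \<exists>m. \<forall>y\<in>topspace X. V m y \<inter> V m x \<noteq> {} \<longrightarrow> V m y \<subseteq> V n x"
  shows "metrizable_space X"
proof -
  have anti: "V m x \<subseteq> V n x" if "n \<le> m" "x \<in> topspace X" for m n x
    using that by (induction m rule: dec_induct) (use dec in blast)+
  obtain \<mu> where \<mu>: "\<And>n x y. \<lbrakk>x \<in> topspace X; y \<in> topspace X; V (\<mu> n x) y \<inter> V (\<mu> n x) x \<noteq> {}\<rbrakk>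
      \<Longrightarrow> V (\<mu> n x) y \<subseteq> V n x"
  proof -
    have "\<forall>n x. \<exists>m. x \<in> topspace X \<longrightarrow>
        (\<forall>y\<in>topspace X. V m y \<inter> V m x \<noteq> {} \<longrightarrow> V m y \<subseteq> V n x)"
      using star by blast
    then show ?thesis using that unfolding choice_iff by blast
  qed
  define \<nu> where "\<nu> k x = rec_nat 0 (\<lambda>k m. max (Suc m) (\<mu> m x)) k" for k x
  have \<nu>_Suc: "\<nu> (Suc k) x = max (Suc (\<nu> k x)) (\<mu> (\<nu> k x) x)" for k x by (simp add: \<nu>_def)
  have \<nu>_ge: "k \<le> \<nu> k x" for k x
    by (induction k) (auto simp: \<nu>_Suc)
  define G where "G k x = V (\<nu> k x) x" for k x
  have G_mem: "x \<in> G k x" if "x \<in> topspace X" for k x using mem that by (simp add: G_def)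
  have G_dec: "G (Suc k) x \<subseteq> G k x" if "x \<in> topspace X" for k x
    unfolding G_def using anti that by (simp add: \<nu>_Suc)
  have G_sub: "G k x \<subseteq> topspace X" if "x \<in> topspace X" for k x
    unfolding G_def using opn that openin_subset by blast
  have G_star: "G (Suc k) y \<subseteq> V n x"
    if "x \<in> topspace X" "y \<in> topspace X" "G (Suc k) y \<inter> V l x \<noteq> {}"
      "\<mu> n x \<le> l" "\<mu> n x \<le> \<nu> (Suc k) y" for k n l x y
  proof -
    have "G (Suc k) y \<subseteq> V (\<mu> n x) y" "V l x \<subseteq> V (\<mu> n x) x"
      unfolding G_def using anti that by auto
    then show ?thesis using \<mu> that(1-3) by fast
  qed
  have G_pair: "\<exists>z\<in>topspace X. G (Suc k) x \<union> G (Suc k) y \<subseteq> G k z"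
    if "x \<in> topspace X" "y \<in> topspace X" "G (Suc k) x \<inter> G (Suc k) y \<noteq> {}" for k x y
  proof -
    \<comment> \<open>Of two members that meet, the one with the larger index is absorbed by the
      other one's set at level \<open>k\<close>, so the centre of the latter serves as
      \<open>z\<close>.\<close>
    have aux: "G (Suc k) y \<subseteq> G k x"
      if "x \<in> topspace X" "y \<in> topspace X" "G (Suc k) x \<inter> G (Suc k) y \<noteq> {}"
        "\<nu> (Suc k) x \<le> \<nu> (Suc k) y" for x y
      using G_star[of x y k "\<nu> (Suc k) x" "\<nu> k x"] that unfolding G_def[of _ x]
      by (auto simp: \<nu>_Suc[of k x])
    show ?thesis
    proof (cases "\<nu> (Suc k) x \<le> \<nu> (Suc k) y")
      case True
      then show ?thesis using aux[OF that] G_dec that by blast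
    next
      case False
      then show ?thesis using aux[of y x] G_dec that by (metis Int_commute Un_least nle_le)
    qed
  qed
  define P where "P k x y \<longleftrightarrow> (\<exists>z\<in>topspace X. x \<in> G k z \<and> y \<in> G k z)" for k x y
  have P_comp: "P k x z" if xy: "P (Suc k) x y" and yz: "P (Suc k) y z" for k x y z
  proof -
    obtain u v where uv: "u \<in> topspace X" "v \<in> topspace X" "x \<in> G (Suc k) u" "y \<in> G (Suc k) u"
        "y \<in> G (Suc k) v" "z \<in> G (Suc k) v"
      using xy yz unfolding P_def by blast
    then obtain t where "t \<in> topspace X" "G (Suc k) u \<union> G (Suc k) v \<subseteq> G k t"
      using G_pair[of u v k] by blast
    then show ?thesis using uv unfolding P_def by blast
  qed
  have P_dec: "P k x y" if "P (Suc k) x y" for k x y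
    using that unfolding P_def by (metis G_dec subsetD)
  have P_base: "\<exists>k. \<forall>y. P k x y \<longrightarrow> y \<in> U" if U: "openin X U" "x \<in> U" for x U
  proof -
    have x: "x \<in> topspace X" using U openin_subset by blast
    obtain n where n: "V n x \<subseteq> U" using base[OF U] by blast
    have "y \<in> U" if xy: "P (Suc (\<mu> n x)) x y" for y
    proof -
      obtain z where z: "z \<in> topspace X" "x \<in> G (Suc (\<mu> n x)) z" "y \<in> G (Suc (\<mu> n x)) z"
        using xy unfolding P_def by blast
      have "\<mu> n x \<le> \<nu> (Suc (\<mu> n x)) z" using \<nu>_ge Suc_leD by blast
      then have "G (Suc (\<mu> n x)) z \<subseteq> V n x"
        using G_star[OF x z(1), of "\<mu> n x" "\<mu> n x" n] x z(2) mem by blast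
      then show ?thesis using z n by blast
    qed
    then show ?thesis by blast
  qed
  show ?thesis
  \<comment> \<open>Each composition of \<open>P\<close> costs one level and three links need two
    compositions, hence only the even levels.\<close>
  proof (rule metrizable_if_uniformity_base[of X "\<lambda>k. P (2 * k)"])
    show "P (2 * k) x x" if "x \<in> topspace X" for k x using that G_mem unfolding P_def by blast
    show "P (2 * k) y x" if "P (2 * k) x y" for k x y using that unfolding P_def by blast
    show "P (2 * k) x y" if "P (2 * Suc k) x y" for k x y using that P_dec by simp
    show "P (2 * k) x w" if "P (2 * Suc k) x y" "P (2 * Suc k) y z" "P (2 * Suc k) z w" for k x y z w
      using that P_comp P_dec by (metis add_2_eq_Suc mult_Suc_right)
    have P_base2: "\<exists>k. \<forall>y. P (2 * k) x y \<longrightarrow> y \<in> U" if U: "openin X U" "x \<in> U" for x U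
    proof -
      obtain k where k: "\<forall>y. P k x y \<longrightarrow> y \<in> U" using P_base[OF U] by blast
      have "P k x y" if "P (k + j) x y" for j y using that by (induction j) (auto intro: P_dec)
      from this[of k] show ?thesis using k by (metis mult_2)
    qed
    show "x = y" if "x \<in> topspace X" "y \<in> topspace X" "\<And>k. P (2 * k) x y" for x y
    proof (rule ccontr)
      assume "x \<noteq> y"
      then obtain U where "openin X U" "x \<in> U" "y \<notin> U"
        using t1 \<open>x \<in> topspace X\<close> \<open>y \<in> topspace X\<close> unfolding t1_space_def by blast
      then show False using P_base2 that(3) by blast
    qed
    show "openin X U \<longleftrightarrow>
       U \<subseteq> topspace X \<and> (\<forall>x\<in>U. \<exists>k. \<forall>y\<in>topspace X. P (2 * k) x y \<longrightarrow> y \<in> U)" for U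
    proof (intro iffI conjI)
      assume "U \<subseteq> topspace X \<and> (\<forall>x\<in>U. \<exists>k. \<forall>y\<in>topspace X. P (2 * k) x y \<longrightarrow> y \<in> U)"
      then have U: "U \<subseteq> topspace X"
        and k: "\<And>x. x \<in> U \<Longrightarrow> \<exists>k. \<forall>y\<in>topspace X. P (2 * k) x y \<longrightarrow> y \<in> U" by blast+
      show "openin X U"
      proof (subst openin_subopen, intro ballI)
        fix x assume "x \<in> U"
        then obtain k where "\<forall>y\<in>topspace X. P (2 * k) x y \<longrightarrow> y \<in> U" using k by blast
        then have "G (2 * k) x \<subseteq> U"
          using \<open>x \<in> U\<close> U G_sub G_mem unfolding P_def by blast
        moreover have "x \<in> topspace X" using \<open>x \<in> U\<close> U by blast
        then have "openin X (G (2 * k) x)" "x \<in> G (2 * k) x"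
          using opn G_mem by (simp_all add: G_def)
        ultimately show "\<exists>T. openin X T \<and> x \<in> T \<and> T \<subseteq> U" by blast
      qed
    next
      assume U: "openin X U"
      then show "U \<subseteq> topspace X" by (rule openin_subset)
      show "\<forall>x\<in>U. \<exists>k. \<forall>y\<in>topspace X. P (2 * k) x y \<longrightarrow> y \<in> U"
        using P_base2[OF U] by blast
    qed
  qed
qed

section \<open>Sequences, barriers and metrizability in rectified spaces\<close>

lemma infinite_ge:
  assumes "infinite {n::nat. P n}"
  obtains n where "m \<le> n" "P n"
  using assms unfolding infinite_nat_iff_unbounded_le by blast

lemma frequently_subseq:
  assumes "infinite {n::nat. P n}"
  shows "\<exists>r :: nat \<Rightarrow> nat. strict_mono r \<and> (\<forall>n. P (r n))"
  using infinite_enumerate[OF assms] by blast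

lemma strict_mono_choice:
  fixes P :: "nat \<Rightarrow> nat \<Rightarrow> bool"
  assumes "\<forall>m. \<exists>k. \<forall>j\<ge>k. P m j"
  shows "\<exists>\<phi>. strict_mono \<phi> \<and> (\<forall>m. P m (\<phi> m))"
proof -
  obtain K where K: "\<And>m j. K m \<le> j \<Longrightarrow> P m j" using assms by metis
  define \<phi> where "\<phi> m = (\<Sum>i\<le>m. Suc (K i))" for m
  have "strict_mono \<phi>" unfolding strict_mono_Suc_iff \<phi>_def by simp
  moreover have "K m \<le> \<phi> m" for m
    unfolding \<phi>_def by (rule order_trans[OF _ member_le_sum[of m]]) auto
  ultimately show ?thesis using K by blast
qed

text \<open>If no value recurs infinitely often, only finitely many arguments have value at most
  \<open>f n\<close>, so a later argument with a larger value always exists.\<close>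

lemma nat_seq_const_or_strict_mono:
  fixes f :: "nat \<Rightarrow> nat"
  obtains (const) m and r :: "nat \<Rightarrow> nat" where "strict_mono r" "\<And>n. f (r n) = m"
  | (strict) r :: "nat \<Rightarrow> nat" where "strict_mono r" "strict_mono (\<lambda>n. f (r n))"
proof (cases "\<exists>m. infinite {n. f n = m}")
  case True
  then obtain m where "infinite {n. f n = m}" by blast
  from frequently_subseq[OF this] show thesis using const by blast
next
  case False
  have "\<exists>y>n. f n < f y" for n
  proof -
    have "finite (\<Union>m\<le>f n. {y. f y = m})" using False by blast
    then have "finite ({y. f y \<le> f n} \<union> {..n})" 
      by (intro finite_UnI finite_atMost) (rule finite_subset[rotated], assumption, auto)
    then have "UNIV - ({y. f y \<le> f n} \<union> {..n}) \<noteq> {}"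
      by (metis Diff_infinite_finite finite.emptyI infinite_UNIV_nat)
    then show ?thesis by (auto simp: not_le)
  qed
  then have "\<exists>r. \<forall>n. True \<and> (r n < r (Suc n) \<and> f (r n) < f (r (Suc n)))"
    by (intro dependent_nat_choice) auto
  then obtain r where r: "\<And>n. r n < r (Suc n)" "\<And>n. f (r n) < f (r (Suc n))" by blast
  then show thesis by (intro strict[of r]) (simp_all add: strict_mono_Suc_iff)
qed

section \<open>Rectified spaces: the operations and convergence\<close>

text \<open>\<open>p x\<close> and \<open>q x\<close> stand for left translation by \<open>x\<close>
  in a group and its inverse, and \<open>e\<close> is a two-sided identity, but no associativity is
  available. Arguments therefore return to \<open>e\<close> through \<open>q\<close> and leave it
  through \<open>p\<close>.\<close>

locale rectified =
  fixes X :: "'a topology" and e :: 'a and p q :: "'a \<Rightarrow> 'a \<Rightarrow> 'a"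
  assumes regular: "regular_space X" and t1: "t1_space X" and sequential: "sequential_space X"
    and e_in [simp]: "e \<in> topspace X"
    and cont_p: "continuous_map (prod_topology X X) X (\<lambda>(x, y). p x y)"
    and cont_q: "continuous_map (prod_topology X X) X (\<lambda>(x, y). q x y)"
    and p_q [simp]: "\<lbrakk>x \<in> topspace X; y \<in> topspace X\<rbrakk> \<Longrightarrow> p x (q x y) = y"
    and q_p [simp]: "\<lbrakk>x \<in> topspace X; y \<in> topspace X\<rbrakk> \<Longrightarrow> q x (p x y) = y"
    and p_e [simp]: "x \<in> topspace X \<Longrightarrow> p x e = x"
    and e_p [simp]: "x \<in> topspace X \<Longrightarrow> p e x = x"
begin

abbreviation S where "S \<equiv> topspace X"
abbreviation conv where "conv s x \<equiv> limitin X s x sequentially"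

lemma p_in [simp]: "\<lbrakk>x \<in> S; y \<in> S\<rbrakk> \<Longrightarrow> p x y \<in> S"
  using continuous_map_image_subset_topspace[OF cont_p] by force

lemma q_in [simp]: "\<lbrakk>x \<in> S; y \<in> S\<rbrakk> \<Longrightarrow> q x y \<in> S"
  using continuous_map_image_subset_topspace[OF cont_q] by force

lemma q_self [simp]: "x \<in> S \<Longrightarrow> q x x = e"
  using q_p[of x e] by simp

lemma q_e [simp]: "x \<in> S \<Longrightarrow> q e x = x"
  using q_p[of e x] by simp

lemma q_eq_e: "\<lbrakk>x \<in> S; y \<in> S; q x y = e\<rbrakk> \<Longrightarrow> y = x"
  using p_q[of x y] by simp

lemma Hausdorff: "Hausdorff_space X"
  using regular t1 regular_t1_imp_Hausdorff_space by blast

lemma conv_unique: "\<lbrakk>conv s x; conv s y\<rbrakk> \<Longrightarrow> x = y"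
  using limitin_Hausdorff_unique[OF _ _ trivial_limit_sequentially Hausdorff] by blast

lemma conv_in: "conv s x \<Longrightarrow> x \<in> S"
  by (rule limitin_topspace)

lemma conv_subseq: "\<lbrakk>conv s x; strict_mono r\<rbrakk> \<Longrightarrow> conv (\<lambda>n. s (r n)) x"
  using limitin_subsequence[of r X s x] by (simp add: o_def)

lemma conv_p: "\<lbrakk>conv s x; conv t y\<rbrakk> \<Longrightarrow> conv (\<lambda>n. p (s n) (t n)) (p x y)"
  using continuous_map_limit[OF cont_p, of "\<lambda>n. (s n, t n)" "(x, y)" sequentially]
  by (simp add: limitin_pairwise o_def)

lemma conv_q: "\<lbrakk>conv s x; conv t y\<rbrakk> \<Longrightarrow> conv (\<lambda>n. q (s n) (t n)) (q x y)"
  using continuous_map_limit[OF cont_q, of "\<lambda>n. (s n, t n)" "(x, y)" sequentially]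
  by (simp add: limitin_pairwise o_def)

lemma conv_const: "x \<in> S \<Longrightarrow> conv (\<lambda>n. x) x"
  by simp

lemma conv_q_self: "conv s x \<Longrightarrow> conv (\<lambda>n. q x (s n)) e"
  using conv_q[OF conv_const, of x s x] conv_in[of s x] by simp

lemma conv_eventually: "\<lbrakk>conv s x; openin X U; x \<in> U\<rbrakk> \<Longrightarrow> \<exists>m. \<forall>n\<ge>m. s n \<in> U"
  using limitinD[of X s x sequentially U] by (simp add: eventually_sequentially)

lemma conv_closedin: "\<lbrakk>conv s x; closedin X C; \<And>n. s n \<in> C\<rbrakk> \<Longrightarrow> x \<in> C"
  by (rule limitin_closedin[of X s x sequentially C]) auto

lemma closedin_if_conv:
  assumes "A \<subseteq> S" "\<And>s x. \<lbrakk>\<And>n. s n \<in> A; conv s x\<rbrakk> \<Longrightarrow> x \<in> A"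
  shows "closedin X A"
  using sequential assms unfolding sequential_space_def by (metis range_subsetD)

lemma openin_if_conv:
  assumes "A \<subseteq> S" "\<And>s x. \<lbrakk>\<And>n. s n \<in> S; conv s x; x \<in> A\<rbrakk> \<Longrightarrow> \<exists>n. s n \<in> A"
  shows "openin X A"
proof -
  have "closedin X (S - A)"
    by (rule closedin_if_conv) (use assms(2) conv_in in blast)+
  then show ?thesis using assms(1) by (simp add: openin_closedin_eq)
qed

lemma regular_nbhd:
  assumes "openin X U" "x \<in> U"
  obtains V where "openin X V" "x \<in> V" "X closure_of V \<subseteq> U"
proof -
  have "closedin X (S - U)" "x \<in> S - (S - U)" using assms openin_subset by auto
  then obtain V where V: "openin X V" "x \<in> V" "disjnt (S - U) (X closure_of V)"
    using regular unfolding regular_space by meson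
  moreover have "X closure_of V \<subseteq> S" by (rule closure_of_subset_topspace)
  ultimately have "X closure_of V \<subseteq> U" by (auto simp: disjnt_iff)
  then show thesis using that V by blast
qed

lemma openin_q_slice: "\<lbrakk>openin X U; x \<in> S\<rbrakk> \<Longrightarrow> openin X {y \<in> S. q x y \<in> U}"
  and openin_q_slice': "\<lbrakk>openin X U; x \<in> S\<rbrakk> \<Longrightarrow> openin X {y \<in> S. q y x \<in> U}"
proof -
  assume U: "openin X U" and x: "x \<in> S"
  have "continuous_map X X (\<lambda>y. q x y)" "continuous_map X X (\<lambda>y. q y x)"
    using x continuous_map_compose[OF _ cont_q, of X "\<lambda>y. (x, y)"]
      continuous_map_compose[OF _ cont_q, of X "\<lambda>y. (y, x)"]
    by (simp_all add: o_def continuous_map_pairwise)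
  then show "openin X {y \<in> S. q x y \<in> U}" "openin X {y \<in> S. q y x \<in> U}"
    using U openin_continuous_map_preimage by blast+
qed

lemma nbhd_pq:
  assumes U: "openin X U" "e \<in> U"
  obtains V where "openin X V" "e \<in> V" "V \<subseteq> U"
    "\<forall>x\<in>V. \<forall>y\<in>V. p x y \<in> U \<and> q x y \<in> U"
proof -
  have "openin (prod_topology X X) {z \<in> topspace (prod_topology X X). (\<lambda>(x, y). p x y) z \<in> U}"
    "openin (prod_topology X X) {z \<in> topspace (prod_topology X X). (\<lambda>(x, y). q x y) z \<in> U}"
    using cont_p cont_q U openin_continuous_map_preimage by blast+
  then have "openin (prod_topology X X)
      ({z \<in> topspace (prod_topology X X). (\<lambda>(x, y). p x y) z \<in> U} \<inter>
       {z \<in> topspace (prod_topology X X). (\<lambda>(x, y). q x y) z \<in> U})" (is "openin _ ?W")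
    by (rule openin_Int)
  moreover have "(e, e) \<in> ?W" using U by simp
  ultimately obtain V1 V2 where V: "openin X V1" "openin X V2" "e \<in> V1" "e \<in> V2" "V1 \<times> V2 \<subseteq> ?W"
    unfolding openin_prod_topology_alt by meson
  show thesis
    by (rule that[of "V1 \<inter> V2 \<inter> U"]) (use V U in \<open>auto intro: openin_Int\<close>)
qed

section \<open>Barriers, neighbourhoods and metrizable subspaces\<close>

text \<open>The sequential counterpart of a relative neighbourhood of \<open>e\<close> in
  \<open>Q\<close>; \<open>barrierD\<close> is the form with almost all terms.\<close>

definition barrier :: "'a set \<Rightarrow> 'a set \<Rightarrow> bool" where
  "barrier Q B \<longleftrightarrow> \<not> (\<exists>s. (\<forall>n. s n \<in> Q - B) \<and> conv s e)"

lemma barrier_contra: "\<lbrakk>barrier Q B; conv s e; \<And>n. s n \<in> Q - B\<rbrakk> \<Longrightarrow> False"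
  unfolding barrier_def by meson

lemma barrierD:
  assumes "barrier Q B" "conv s e" "\<And>n. s n \<in> Q"
  shows "\<exists>m. \<forall>n\<ge>m. s n \<in> B"
proof (rule ccontr)
  assume "\<nexists>m. \<forall>n\<ge>m. s n \<in> B"
  then have "infinite {n. s n \<notin> B}" unfolding infinite_nat_iff_unbounded_le by blast
  from frequently_subseq[OF this] obtain r :: "nat \<Rightarrow> nat"
    where r: "strict_mono r" "\<And>n. s (r n) \<notin> B" by blast
  then have "s (r n) \<in> Q - B" for n using assms(3) by blast
  then show False by (rule barrier_contra[OF assms(1) conv_subseq[OF assms(2) r(1)]])
qed

text \<open>In the sequential space \<open>X\<close>, the points of \<open>Q\<close> that have a translate of a barrier inside \<open>B n\<close>
  form a relatively open set.\<close>

lemma barriers_imp_nbhds: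
  fixes B :: "nat \<Rightarrow> 'a set"
  assumes Q: "closedin X Q" "e \<in> Q" and Q': "Q' \<subseteq> S" "\<And>x y. \<lbrakk>x \<in> Q; y \<in> Q\<rbrakk> \<Longrightarrow> q x y \<in> Q'"
    and bar: "\<And>n. barrier Q' (B n)"
    and base: "\<And>U. \<lbrakk>openin X U; e \<in> U\<rbrakk> \<Longrightarrow> \<exists>n. B n \<subseteq> U"
  obtains G where "openin X G" "e \<in> G" "G \<inter> Q \<subseteq> B n"
proof -
  have QS: "Q \<subseteq> S" using Q closedin_subset by blast
  have eQ': "e \<in> Q'" using Q' Q QS by (metis q_self subsetD)
  \<comment> \<open>Any choice of points \<open>b k \<in> R k\<close> tends to \<open>e\<close> by
    \<open>base\<close>, while every sequence in \<open>Q'\<close> tending to \<open>e\<close> meets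
    each \<open>R k\<close>.\<close>
  define R where "R k = Q' \<inter> (\<Inter>i\<le>k. B i)" for k :: nat
  have R_ev: "\<exists>m. s m \<in> R k" if s: "conv s e" "\<And>n. s n \<in> Q'" for s k
  proof -
    have "\<exists>m. \<forall>n\<ge>m. \<forall>i\<le>k. s n \<in> B i"
    proof (induction k)
      case 0 then show ?case using barrierD[OF bar s] by simp
    next
      case (Suc k)
      then obtain m where "\<forall>n\<ge>m. \<forall>i\<le>k. s n \<in> B i" by blast
      moreover obtain m' where "\<forall>n\<ge>m'. s n \<in> B (Suc k)" using barrierD[OF bar s] by blast
      ultimately show ?case by (intro exI[of _ "max m m'"]) (auto simp: le_Suc_eq)
    qed
    then show ?thesis unfolding R_def using s(2) by auto
  qed
  have eR: "e \<in> R k" for k using R_ev[OF conv_const[OF e_in]] eQ' by auto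
  have RS: "R k \<subseteq> S" for k using Q'(1) unfolding R_def by blast
  have R_conv: "conv b e" if b: "\<And>k. b k \<in> R k" for b
    unfolding limitin_sequentially
  proof (intro conjI e_in allI impI, elim conjE)
    fix U assume "openin X U" "e \<in> U"
    then obtain n where "B n \<subseteq> U" using base by blast
    then have "b k \<in> U" if "n \<le> k" for k using b[of k] that unfolding R_def by blast
    then show "\<exists>N. \<forall>n\<ge>N. b n \<in> U" by blast
  qed
  define W where "W = {x \<in> Q. \<exists>k. \<forall>b\<in>R k. p x b \<in> Q \<longrightarrow> p x b \<in> B n}"
  \<comment> \<open>If points \<open>y j\<close> outside \<open>W\<close> tended to some
    \<open>x \<in> W\<close>, their witnesses \<open>p (y j) (b j)\<close> would tend to
    \<open>x\<close> as well. Seen from \<open>x\<close> they then enter \<open>R k\<close>, which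
    puts one of them into \<open>B n\<close>.\<close>
  have "closedin X (Q - W)"
  proof (rule closedin_if_conv)
    show "Q - W \<subseteq> S" using QS by blast
    fix y x assume y: "\<And>j. y j \<in> Q - W" and conv: "conv y x"
    have xQ: "x \<in> Q" using conv_closedin[OF conv Q(1)] y by blast
    have "x \<notin> W"
    proof
      assume "x \<in> W"
      then obtain k where k: "\<forall>b\<in>R k. p x b \<in> Q \<longrightarrow> p x b \<in> B n" unfolding W_def by blast
      have "\<forall>j. \<exists>b. b \<in> R j \<and> p (y j) b \<in> Q \<and> p (y j) b \<notin> B n"
        using y unfolding W_def by blast
      then obtain b where b: "\<And>j. b j \<in> R j" "\<And>j. p (y j) (b j) \<in> Q" "\<And>j. p (y j) (b j) \<notin> B n"
        by metis
      have "conv (\<lambda>j. p (y j) (b j)) (p x e)" using conv_p[OF conv R_conv[OF b(1)]] .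
      then have "conv (\<lambda>j. p (y j) (b j)) x" using conv_in[OF conv] by simp
      then have "conv (\<lambda>j. q x (p (y j) (b j))) e" by (rule conv_q_self)
      moreover have "q x (p (y j) (b j)) \<in> Q'" for j using Q'(2) xQ b(2) by blast
      ultimately obtain j where "q x (p (y j) (b j)) \<in> R k" using R_ev by blast
      then have "p x (q x (p (y j) (b j))) \<in> Q \<longrightarrow> p x (q x (p (y j) (b j))) \<in> B n"
        using k by blast
      moreover have "p x (q x (p (y j) (b j))) = p (y j) (b j)"
        using xQ b(2) QS by (meson p_q subsetD)
      ultimately show False using b(2,3) by simp
    qed
    then show "x \<in> Q - W" using xQ by blast
  qed
  moreover have "e \<in> W"
  proof (rule ccontr)
    assume "e \<notin> W"
    then have "\<forall>k. \<exists>b. b \<in> R k \<and> p e b \<in> Q \<and> p e b \<notin> B n" unfolding W_def using Q by blast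
    then obtain b where b: "\<And>j. b j \<in> R j" "\<And>j. p e (b j) \<notin> B n" by metis
    have "b j \<in> S" "b j \<in> Q'" for j using b(1) RS unfolding R_def by blast+
    then have "\<And>j. b j \<in> Q' - B n" using b(2) by simp
    then show False by (rule barrier_contra[OF bar R_conv[OF b(1)]])
  qed
  moreover have "W \<subseteq> B n"
  proof
    fix x assume "x \<in> W"
    then have "x \<in> Q" "p x e \<in> Q \<longrightarrow> p x e \<in> B n" unfolding W_def using eR by blast+
    then show "x \<in> B n" using QS by auto
  qed
  \<comment> \<open>The complement of \<open>Q - W\<close> is open and its trace on \<open>Q\<close>
    is \<open>W\<close>.\<close>
  ultimately show thesis
    using that[of "S - (Q - W)"] Q by (auto simp: openin_closedin_eq)
qed

text \<open>\<open>key\<close> says that points \<open>q\<close>-close to a convergent sequence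
  subconverge to the same limit. This yields both the base property and the local star condition for
  the sets \<open>V n x\<close> below: a failure produces points that are ever closer to
  \<open>x\<close> and yet avoid a fixed neighbourhood of it.\<close>

lemma metrizable_subspace:
  fixes G :: "nat \<Rightarrow> 'a set"
  assumes K: "K \<subseteq> S" and G: "\<And>n. openin X (G n)" "\<And>n. e \<in> G n" "\<And>n. G (Suc n) \<subseteq> G n"
    and key: "\<And>s t x. \<lbrakk>conv s x; x \<in> K; \<And>n. s n \<in> K; \<And>n. t n \<in> K; \<And>n. q (s n) (t n) \<in> G n\<rbrakk>
      \<Longrightarrow> \<exists>r. strict_mono r \<and> conv (\<lambda>n. t (r n)) x"
  shows "metrizable_space (subtopology X K)"
proof -
  have top: "topspace (subtopology X K) = K" using K by auto
  have anti: "G m \<subseteq> G n" if "n \<le> m" for m n using that lift_Suc_antimono_le[of G] G(3) by blast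
  \<comment> \<open>Closeness is asked for in both orders because the star argument steps from
    \<open>a\<close> to \<open>y\<close> as well as from \<open>y\<close> to
    \<open>b\<close>.\<close>
  define V where "V n x = {y \<in> K. q x y \<in> G n \<and> q y x \<in> G n}" for n x
  have mem: "x \<in> V n x" if "x \<in> K" for n x using that K G by (auto simp: V_def)
  have opn: "openin (subtopology X K) (V n x)" if "x \<in> K" for n x
  proof -
    have "V n x = K \<inter> ({y \<in> S. q x y \<in> G n} \<inter> {y \<in> S. q y x \<in> G n})"
      unfolding V_def using K by blast
    moreover have "x \<in> S" using K that by blast
    then have "openin X ({y \<in> S. q x y \<in> G n} \<inter> {y \<in> S. q y x \<in> G n})"
      using openin_q_slice[OF G(1)] openin_q_slice'[OF G(1)] by (simp add: openin_Int)
    ultimately show ?thesis by (simp add: openin_subtopology_Int2)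
  qed
  have not_conv: False
    if "conv b x" "x \<in> U" "openin (subtopology X K) U" "\<And>n::nat. b n \<in> K - U" for b x U
  proof -
    obtain T where T: "openin X T" "U = T \<inter> K" using \<open>openin (subtopology X K) U\<close>
      by (auto simp: openin_subtopology)
    then obtain n where "b n \<in> T" using conv_eventually[OF \<open>conv b x\<close> T(1)] \<open>x \<in> U\<close> by blast
    then show False using T that(4) by blast
  qed
  show ?thesis
  proof (rule metrizable_if_local_star_base[where V = V], unfold top)
    show "t1_space (subtopology X K)" using t1 by (rule t1_space_subtopology)
    show "V (Suc n) x \<subseteq> V n x" for n x unfolding V_def using G(3) by blast
    show "\<exists>n. V n x \<subseteq> U" if U: "openin (subtopology X K) U" "x \<in> U" for U x
    proof (rule ccontr)
      assume "\<nexists>n. V n x \<subseteq> U"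
      then have "\<forall>n. \<exists>b. b \<in> V n x - U" by blast
      then obtain b where b: "\<And>n. b n \<in> V n x - U" by metis
      have x: "x \<in> K" using openin_subset[OF U(1)] U(2) top by blast
      then have "conv (\<lambda>n. x) x" using K by auto
      then obtain r where "conv (\<lambda>n. b (r n)) x"
        using key[of "\<lambda>n. x" x b] x b unfolding V_def by blast
      then show False using not_conv U b unfolding V_def by blast
    qed
    show "\<exists>m. \<forall>y\<in>K. V m y \<inter> V m x \<noteq> {} \<longrightarrow> V m y \<subseteq> V n x" if x: "x \<in> K" for x n
    proof (rule ccontr)
      assume "\<not> ?thesis"
      then have "\<forall>m. \<exists>y a b. y \<in> K \<and> a \<in> V m y \<and> a \<in> V m x \<and> b \<in> V m y \<and> b \<notin> V n x"
        by blast
      then obtain y a b where *: "\<And>m. y m \<in> K" "\<And>m. a m \<in> V m (y m)" "\<And>m. a m \<in> V m x"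
          "\<And>m. b m \<in> V m (y m)" "\<And>m. b m \<notin> V n x"
        by metis
      have K': "a m \<in> K" "b m \<in> K" "q x (a m) \<in> G m" "q (a m) (y m) \<in> G m" "q (y m) (b m) \<in> G m" for m
        using *(2,3,4)[of m] unfolding V_def by blast+
      have "conv (\<lambda>n. x) x" using K x by auto
      \<comment> \<open>Follow the chain \<open>x\<close>, \<open>a m\<close>, \<open>y m\<close>,
        \<open>b m\<close>. Each application of \<open>key\<close> passes to a subsequence, whose
        \<open>n\<close>-th index is at least \<open>n\<close>, so the memberships in
        \<open>G n\<close> persist.\<close>
      from key[OF this x x K'(1,3)]
      obtain r1 where r1: "strict_mono r1" "conv (\<lambda>n. a (r1 n)) x" by blast
      have g: "G (r1 n) \<subseteq> G n" for n using anti seq_suble[OF r1(1)] by blast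
      from key[OF r1(2) x K'(1) *(1) subsetD[OF g K'(4)]]
      obtain r2 where r2: "strict_mono r2" "conv (\<lambda>n. y (r1 (r2 n))) x" by blast
      have g': "G (r1 (r2 n)) \<subseteq> G n" for n
        using g anti[OF seq_suble[OF r2(1)]] by blast
      from key[OF r2(2) x *(1) K'(2) subsetD[OF g' K'(5)]]
      obtain r3 where "conv (\<lambda>n. b (r1 (r2 (r3 n)))) x" by blast
      then show False
        using not_conv[of "\<lambda>n. b (r1 (r2 (r3 n)))", OF _ mem[OF x] opn[OF x]] K'(2) *(5) by auto
    qed
  qed (fact mem opn)+
qed

text \<open>With \<open>Q = Q' = S\<close> the barriers contain neighbourhoods, which form a
  countable base at \<open>e\<close>. If \<open>s n\<close> tends to \<open>x\<close> and
  \<open>q (s n) (t n)\<close> to \<open>e\<close>, then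
  \<open>t n = p (s n) (q (s n) (t n))\<close> tends to \<open>p x e = x\<close>, as
  \<open>metrizable_subspace\<close> demands.\<close>

lemma metrizable_if_barriers:
  fixes B :: "nat \<Rightarrow> 'a set"
  assumes bar: "\<And>n. barrier S (B n)"
    and base: "\<And>U. \<lbrakk>openin X U; e \<in> U\<rbrakk> \<Longrightarrow> \<exists>n. B n \<subseteq> U"
  shows "metrizable_space X"
proof -
  have "\<forall>n. \<exists>G. openin X G \<and> e \<in> G \<and> G \<subseteq> B n"
  proof
    fix n
    obtain G where "openin X G" "e \<in> G" "G \<inter> S \<subseteq> B n"
      by (rule barriers_imp_nbhds[OF closedin_topspace e_in subset_refl q_in bar base, of n])
    then show "\<exists>G. openin X G \<and> e \<in> G \<and> G \<subseteq> B n" using openin_subset[of X G] by blast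
  qed
  then obtain G where G: "\<And>n. openin X (G n)" "\<And>n. e \<in> G n" "\<And>n. G n \<subseteq> B n" by metis
  have "metrizable_space (subtopology X S)"
  proof (rule metrizable_subspace[where G = "\<lambda>n. \<Inter>i\<le>n. G i"])
    fix s t x
    assume st: "conv s x" "\<And>n. s n \<in> S" "\<And>n. t n \<in> S" "\<And>n. q (s n) (t n) \<in> (\<Inter>i\<le>n. G i)"
    have "conv (\<lambda>n. q (s n) (t n)) e"
      unfolding limitin_sequentially
    proof (intro conjI e_in allI impI, elim conjE)
      fix U assume "openin X U" "e \<in> U"
      then obtain n where "G n \<subseteq> U" using base G(3) by (meson subset_trans)
      then have "q (s k) (t k) \<in> U" if "n \<le> k" for k using st(4)[of k] that by blast
      then show "\<exists>N. \<forall>n\<ge>N. q (s n) (t n) \<in> U" by blast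
    qed
    from conv_p[OF st(1) this] have "conv t x" using st conv_in[OF st(1)] by simp
    then show "\<exists>r. strict_mono r \<and> conv (\<lambda>n. t (r n)) x"
      by (intro exI[of _ id]) (simp add: strict_mono_id)
  qed (use G in \<open>auto intro!: openin_INT\<close>)
  then show ?thesis by simp
qed

section \<open>Sequential compactness\<close>

text \<open>Closures are nested so that a limit of points \<open>u n \<in> G n\<close> lies in every
  \<open>G k\<close>; see \<open>nested_limit\<close>.\<close>

definition nested :: "(nat \<Rightarrow> 'a set) \<Rightarrow> bool" where
  "nested G \<longleftrightarrow> (\<forall>n. openin X (G n) \<and> e \<in> G n \<and> X closure_of G (Suc n) \<subseteq> G n)"

lemma nested_Suc: "nested G \<Longrightarrow> G (Suc n) \<subseteq> G n"
  using closure_of_subset[of "G (Suc n)" X] openin_subset[of X "G (Suc n)"]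
  unfolding nested_def by blast

lemma nested_limit:
  assumes G: "nested G" and u: "conv u c" "\<And>n. u n \<in> G n"
  shows "c \<in> G k"
proof -
  have "G m \<subseteq> G n" if "n \<le> m" for m n
    using that lift_Suc_antimono_le[of G] nested_Suc[OF G] by blast
  then have "u (n + Suc k) \<in> G (Suc k)" for n using u(2) le_add2 by blast
  then have "u (n + Suc k) \<in> X closure_of G (Suc k)" for n
    using G closure_of_subset[of "G (Suc k)" X] openin_subset unfolding nested_def by blast
  moreover have "conv (\<lambda>n. u (n + Suc k)) c"
    using conv_subseq[OF u(1), of "\<lambda>n. n + Suc k"] by (simp add: strict_mono_def)
  ultimately have "c \<in> X closure_of G (Suc k)"
    using conv_closedin[of "\<lambda>n. u (n + Suc k)" c "X closure_of G (Suc k)"] by simp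
  then show ?thesis using G unfolding nested_def by blast
qed

lemma nested_refinement:
  assumes H: "\<And>n. openin X (H n)" "\<And>n. e \<in> H n"
  obtains G where "nested G" "\<And>n. G n \<subseteq> H n"
proof -
  have "\<exists>G. \<forall>n. (openin X (G n) \<and> e \<in> G n \<and> G n \<subseteq> H n) \<and> X closure_of (G (Suc n)) \<subseteq> G n"
  proof (rule dependent_nat_choice)
    show "\<exists>V. openin X V \<and> e \<in> V \<and> V \<subseteq> H 0" using H by blast
    fix U n assume U: "openin X U \<and> e \<in> U \<and> U \<subseteq> H n"
    then have "openin X (U \<inter> H (Suc n))" "e \<in> U \<inter> H (Suc n)" using H by auto
    from regular_nbhd[OF this] obtain V where
      V: "openin X V" "e \<in> V" "X closure_of V \<subseteq> U \<inter> H (Suc n)" by blast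
    moreover have "V \<subseteq> X closure_of V" using V(1) by (simp add: closure_of_subset openin_subset)
    ultimately show "\<exists>V. (openin X V \<and> e \<in> V \<and> V \<subseteq> H (Suc n)) \<and> X closure_of V \<subseteq> U" by blast
  qed
  then show thesis using that unfolding nested_def by blast
qed

definition seq_compactin :: "'a set \<Rightarrow> bool" where
  "seq_compactin K \<longleftrightarrow> K \<subseteq> S \<and>
     (\<forall>s :: nat \<Rightarrow> 'a. (\<forall>n. s n \<in> K) \<longrightarrow> 
        (\<exists>r c. strict_mono r \<and> c \<in> K \<and> conv (\<lambda>n. s (r n)) c))"

lemma seq_compactinD:
  fixes s :: "nat \<Rightarrow> 'a"
  assumes K: "seq_compactin K" and s: "\<And>n. s n \<in> K"
  obtains r :: "nat \<Rightarrow> nat" and c where "strict_mono r" "c \<in> K" "conv (\<lambda>n. s (r n)) c"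
proof -
  have "\<exists>r c. strict_mono r \<and> c \<in> K \<and> conv (\<lambda>n. s (r n)) c"
    using K s unfolding seq_compactin_def by simp
  then show thesis using that by (elim exE conjE)
qed

lemma seq_compactin_closedin: "seq_compactin K \<Longrightarrow> closedin X K"
proof (rule closedin_if_conv)
  assume K: "seq_compactin K"
  then show "K \<subseteq> S" by (simp add: seq_compactin_def)
  fix s x assume s: "\<And>n. s n \<in> K" "conv s x"
  obtain r c where r: "strict_mono r" "c \<in> K" "conv (\<lambda>n. s (r n)) c"
    by (rule seq_compactinD[OF K s(1)])
  then show "x \<in> K" using conv_unique[OF conv_subseq[OF s(2) r(1)] r(3)] by simp
qed

lemma seq_compactin_sing: "seq_compactin {e}"
  unfolding seq_compactin_def
proof (intro conjI allI impI)
  fix s :: "nat \<Rightarrow> 'a" assume "\<forall>n. s n \<in> {e}"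
  then show "\<exists>r c. strict_mono r \<and> c \<in> {e} \<and> conv (\<lambda>n. s (r n)) c"
    by (intro exI[of _ id] exI[of _ e]) (simp add: strict_mono_id)
qed simp

lemma seq_compactin_Un:
  assumes K: "seq_compactin K" and L: "seq_compactin L"
  shows "seq_compactin (K \<union> L)"
  unfolding seq_compactin_def
proof (intro conjI allI impI)
  show "K \<union> L \<subseteq> S" using K L by (simp add: seq_compactin_def)
  fix s :: "nat \<Rightarrow> 'a" assume s: "\<forall>n. s n \<in> K \<union> L"
  have *: "\<exists>r c. strict_mono r \<and> c \<in> K \<union> L \<and> conv (\<lambda>n. s (r n)) c"
    if M: "seq_compactin M" "M \<subseteq> K \<union> L" "infinite {n. s n \<in> M}" for M
  proof -
    obtain r :: "nat \<Rightarrow> nat" where r: "strict_mono r" "\<And>n. s (r n) \<in> M"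
      using frequently_subseq[OF M(3)] by blast
    obtain r' c where "strict_mono r'" "c \<in> M" "conv (\<lambda>n. s (r (r' n))) c"
      by (rule seq_compactinD[OF M(1) r(2)])
    then show ?thesis

      using M(2) strict_mono_o[OF r(1), of r']
      by (intro exI[of _ "r \<circ> r'"] exI[of _ c]) auto
  qed
  have "{n. s n \<in> K} \<union> {n. s n \<in> L} = UNIV" using s by blast
  then have "infinite ({n. s n \<in> K} \<union> {n. s n \<in> L})" by simp
  then show "\<exists>r c. strict_mono r \<and> c \<in> K \<union> L \<and> conv (\<lambda>n. s (r n)) c"
    using *[OF K] *[OF L] by auto
qed

lemma seq_compactin_p:
  assumes K: "seq_compactin K" and L: "seq_compactin L"
  shows "seq_compactin {p x y | x y. x \<in> K \<and> y \<in> L}" (is "seq_compactin ?P")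
  unfolding seq_compactin_def
proof (intro conjI allI impI)
  show "?P \<subseteq> S" using K L unfolding seq_compactin_def by (auto intro!: p_in)
  fix s :: "nat \<Rightarrow> 'a" assume "\<forall>n. s n \<in> ?P"
  then have "\<forall>n. \<exists>x y. s n = p x y \<and> x \<in> K \<and> y \<in> L" by blast
  then obtain x y where xy: "\<And>n. s n = p (x n) (y n)" "\<And>n. x n \<in> K" "\<And>n. y n \<in> L" by metis
  obtain r c where r: "strict_mono r" "c \<in> K" "conv (\<lambda>n. x (r n)) c"
    by (rule seq_compactinD[OF K xy(2)])
  obtain r' c' where r': "strict_mono r'" "c' \<in> L" "conv (\<lambda>n. y (r (r' n))) c'"
    by (rule seq_compactinD[OF L xy(3), of r])
  have "conv (\<lambda>n. s (r (r' n))) (p c c')"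
    unfolding xy(1) by (rule conv_p[OF conv_subseq[OF r(3) r'(1)] r'(3)])
  then show "\<exists>r c. strict_mono r \<and> c \<in> ?P \<and> conv (\<lambda>n. s (r n)) c"
    using r r' strict_mono_o[OF r(1), of r']
    by (intro exI[of _ "r \<circ> r'"] exI[of _ "p c c'"]) auto
qed

text \<open>If \<open>s n\<close> tends to \<open>x\<close>, a subsequence of \<open>t\<close> has
  some limit \<open>c\<close>, and \<open>q x c\<close> is a limit of points of \<open>G n\<close>,
  hence equals \<open>e\<close>, so \<open>c = x\<close>. This is the condition of
  \<open>metrizable_subspace\<close>; in the resulting metric, sequential compactness is
  compactness.\<close>

lemma seq_compactin_imp_compact_metrizable:
  assumes K: "seq_compactin K" and G: "nested G" "(\<Inter>n. G n) = {e}"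
  shows "metrizable_space (subtopology X K)" "compactin X K"
proof -
  have KS: "K \<subseteq> S" using K by (simp add: seq_compactin_def)
  show metr: "metrizable_space (subtopology X K)"
  proof (rule metrizable_subspace[where G = G])
    show "\<And>n. openin X (G n)" "\<And>n. e \<in> G n" using G(1) by (simp_all add: nested_def)
    show "\<And>n. G (Suc n) \<subseteq> G n" using G(1) by (rule nested_Suc)
    fix s t x
    assume st: "conv s x" "x \<in> K" "\<And>n. s n \<in> K" "\<And>n. t n \<in> K" "\<And>n. q (s n) (t n) \<in> G n"
    obtain r c where r: "strict_mono r" "c \<in> K" "conv (\<lambda>n. t (r n)) c"
      by (rule seq_compactinD[OF K st(4)])
    have "conv (\<lambda>n. q (s (r n)) (t (r n))) (q x c)"
      by (rule conv_q[OF conv_subseq[OF st(1) r(1)] r(3)])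
    moreover have "q (s (r n)) (t (r n)) \<in> G n" for n
      using st(5)[of "r n"] seq_suble[OF r(1), of n]
        lift_Suc_antimono_le[of G n "r n"] nested_Suc[OF G(1)] by blast
    ultimately have "q x c \<in> (\<Inter>n. G n)" using nested_limit[OF G(1)] by blast
    then have "c = x" using q_eq_e G(2) st(2) r(2) KS by blast
    then show "\<exists>r. strict_mono r \<and> conv (\<lambda>n. t (r n)) x" using r by blast
  qed (fact KS)
  obtain M d where Md: "Metric_space M d" "subtopology X K = Metric_space.mtopology M d"
    using metr unfolding metrizable_space_def by blast
  interpret Metric_space M d by (fact Md(1))
  have M: "M = K" using Md(2) topspace_mtopology topspace_subtopology KS by (metis inf_absorb2)
  have "compact_space mtopology"
    unfolding compact_space_sequentially
  proof (intro allI impI)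
    fix \<sigma> :: "nat \<Rightarrow> 'a" assume "range \<sigma> \<subseteq> M"
    then have \<sigma>: "\<And>n. \<sigma> n \<in> K" using M by blast
    obtain r c where r: "strict_mono r" "c \<in> K" "conv (\<lambda>n. \<sigma> (r n)) c"
      by (rule seq_compactinD[OF K \<sigma>])
    then have "limitin (subtopology X K) (\<sigma> \<circ> r) c sequentially"
      using \<sigma> by (simp add: limitin_subtopology o_def)
    then show "\<exists>l r. l \<in> M \<and> strict_mono r \<and> limitin mtopology (\<sigma> \<circ> r) l sequentially"
      using r Md(2) M by auto
  qed
  then show "compactin X K" using KS Md(2) by (simp add: compactin_subspace)
qed

section \<open>Compactness up to perturbation\<close>

text \<open>Subconvergence is asked of the points \<open>q x y\<close> only after a perturbation by
  terms of \<open>T\<close>, and the limit may lie outside \<open>M\<close>. For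
  \<open>e \<in> M\<close> the choice \<open>x = e\<close> covers perturbations of points of
  \<open>M\<close> themselves.\<close>

definition pseudocompact_along :: "'a set \<Rightarrow> (nat \<Rightarrow> 'a) \<Rightarrow> bool" where
  "pseudocompact_along M T \<longleftrightarrow>
     (\<forall>x y (\<phi> :: nat \<Rightarrow> nat). (\<forall>n. x n \<in> M) \<and> (\<forall>n. y n \<in> M) \<and> strict_mono \<phi> \<longrightarrow>
        (\<exists>r c. strict_mono r \<and> conv (\<lambda>n. p (q (x (r n)) (y (r n))) (T (\<phi> (r n)))) c))"

lemma pseudocompact_alongD:
  fixes \<phi> :: "nat \<Rightarrow> nat"
  assumes M: "pseudocompact_along M T" and xy: "\<And>n. x n \<in> M" "\<And>n. y n \<in> M" "strict_mono \<phi>"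
  obtains r :: "nat \<Rightarrow> nat" and c where "strict_mono r" "conv (\<lambda>n. p (q (x (r n)) (y (r n))) (T (\<phi> (r n)))) c"
proof -
  have "\<exists>r c. strict_mono r \<and> conv (\<lambda>n. p (q (x (r n)) (y (r n))) (T (\<phi> (r n)))) c"
    using M xy unfolding pseudocompact_along_def by simp
  then show thesis using that by (elim exE conjE)
qed

lemma conv_p_const:
  assumes "x \<in> S" "conv T e"
  shows "conv (\<lambda>j. p x (T j)) x"
  using conv_p[OF conv_const[OF assms(1)] assms(2)] assms(1) by simp

text \<open>A sequence \<open>x\<close> in \<open>M\<close> is perturbed twice, to \<open>w\<close> and \<open>x'\<close>; both have limits, which are
  the same because \<open>e\<close> is a \<open>G\<^sub>\<delta>\<close> point, while \<open>x'\<close> can be kept away from \<open>lim w\<close> if \<open>x\<close> does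
  not converge to \<open>lim w\<close>.\<close>

lemma pseudocompact_along_imp_seq_compactin:
  assumes M: "closedin X M" "e \<in> M" "pseudocompact_along M T" and T: "conv T e" "\<And>n. T n \<in> S"
    and G: "nested G" "(\<Inter>n. G n) = {e}"
  shows "seq_compactin M"
  unfolding seq_compactin_def
proof (intro conjI allI impI)
  show MS: "M \<subseteq> S" using M(1) by (rule closedin_subset)
  have anti: "G m \<subseteq> G n" if "n \<le> m" for m n
    using that lift_Suc_antimono_le[of G] nested_Suc[OF G(1)] by blast
  have Gn: "openin X (G n)" "e \<in> G n" for n using G(1) by (simp_all add: nested_def)
  have pert: "\<exists>r c. strict_mono r \<and> conv (\<lambda>n. p (x (r n)) (T (\<phi> (r n)))) c"
    if x: "\<forall>n. x n \<in> M" "strict_mono \<phi>" for x and \<phi> :: "nat \<Rightarrow> nat"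
  proof -
    obtain r c where "strict_mono r" "conv (\<lambda>n. p (q e (x (r n))) (T (\<phi> (r n)))) c"
      by (rule pseudocompact_alongD[OF M(3) M(2) spec[OF x(1)] x(2)])
    moreover have "q e (x n) = x n" for n using x(1) MS by (intro q_e) blast
    ultimately show ?thesis by auto
  qed
  fix x :: "nat \<Rightarrow> 'a" assume x: "\<forall>n. x n \<in> M"
  then have xM: "\<And>n. x n \<in> M" and xS: "\<And>n. x n \<in> S" using MS by blast+
  \<comment> \<open>The first perturbation, \<open>w m\<close>, is so small that
    \<open>q (w m) (x m)\<close> lies in \<open>G m\<close>.\<close>
  have "\<forall>m. \<exists>k. \<forall>j\<ge>k. q (p (x m) (T j)) (x m) \<in> G m"
  proof
    fix m
    have "conv (\<lambda>j. q (p (x m) (T j)) (x m)) (q (x m) (x m))"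
      by (rule conv_q[OF conv_p_const[OF xS T(1)] conv_const[OF xS]])
    then show "\<exists>k. \<forall>j\<ge>k. q (p (x m) (T j)) (x m) \<in> G m"
      using conv_eventually[OF _ Gn(1)] Gn(2) xS by simp
  qed
  from strict_mono_choice[OF this]
  obtain \<phi> where \<phi>: "strict_mono \<phi>" "\<And>m. q (p (x m) (T (\<phi> m))) (x m) \<in> G m" by blast
  define w where "w m = p (x m) (T (\<phi> m))" for m
  have wS: "w m \<in> S" for m unfolding w_def using xS T(2) by simp
  obtain \<rho> c where \<rho>: "strict_mono \<rho>" "conv (\<lambda>n. w (\<rho> n)) c"
    using pert[OF x \<phi>(1)] unfolding w_def by blast
  have "conv (\<lambda>n. x (\<rho> n)) c"
  proof (rule ccontr)
    assume "\<not> conv (\<lambda>n. x (\<rho> n)) c"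
    then obtain V where V: "openin X V" "c \<in> V" "\<not> (\<exists>N. \<forall>n\<ge>N. x (\<rho> n) \<in> V)"
      unfolding limitin_sequentially using conv_in[OF \<rho>(2)] by blast
    then have "infinite {n. x (\<rho> n) \<notin> V}" unfolding infinite_nat_iff_unbounded_le by blast
    from frequently_subseq[OF this] obtain \<rho>' :: "nat \<Rightarrow> nat"
      where \<rho>': "strict_mono \<rho>'" "\<And>n. x (\<rho> (\<rho>' n)) \<notin> V" by blast
    define \<tau> where "\<tau> n = \<rho> (\<rho>' n)" for n
    have \<tau>: "n \<le> \<tau> n" for n
      unfolding \<tau>_def using seq_suble[OF \<rho>(1)] seq_suble[OF \<rho>'(1)] order_trans by blast
    obtain V' where V': "openin X V'" "c \<in> V'" "X closure_of V' \<subseteq> V"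
      using regular_nbhd[OF V(1,2)] by blast
    \<comment> \<open>Nearness to \<open>w (\<tau> m)\<close> and avoidance of the closure of
      \<open>V'\<close> are open conditions that hold at \<open>x (\<tau> m)\<close>, so small
      second perturbations satisfy them too.\<close>
    have "\<forall>m. \<exists>k. \<forall>j\<ge>k. q (w (\<tau> m)) (p (x (\<tau> m)) (T j)) \<in> G (\<tau> m) \<and>
        p (x (\<tau> m)) (T j) \<in> S - X closure_of V'"
    proof
      fix m
      have c1: "conv (\<lambda>j. p (x (\<tau> m)) (T j)) (x (\<tau> m))" by (rule conv_p_const[OF xS T(1)])
      have "conv (\<lambda>j. q (w (\<tau> m)) (p (x (\<tau> m)) (T j))) (q (w (\<tau> m)) (x (\<tau> m)))"
        by (rule conv_q[OF conv_const[OF wS] c1])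
      moreover have "q (w (\<tau> m)) (x (\<tau> m)) \<in> G (\<tau> m)" using \<phi>(2) unfolding w_def by blast
      ultimately obtain k1 where k1: "\<forall>j\<ge>k1. q (w (\<tau> m)) (p (x (\<tau> m)) (T j)) \<in> G (\<tau> m)"
        using conv_eventually Gn by blast
      have "openin X (S - X closure_of V')"
        by (intro openin_diff openin_topspace closedin_closure_of)
      moreover have "x (\<tau> m) \<in> S - X closure_of V'"
        using \<rho>'(2) V'(3) xS unfolding \<tau>_def by blast
      ultimately obtain k2 where "\<forall>j\<ge>k2. p (x (\<tau> m)) (T j) \<in> S - X closure_of V'"
        using conv_eventually[OF c1] by blast
      with k1 show "\<exists>k. \<forall>j\<ge>k. q (w (\<tau> m)) (p (x (\<tau> m)) (T j)) \<in> G (\<tau> m) \<and>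
          p (x (\<tau> m)) (T j) \<in> S - X closure_of V'"
        by (intro exI[of _ "max k1 k2"]) simp
    qed
    from strict_mono_choice[OF this] obtain \<psi> where \<psi>: "strict_mono \<psi>"
      "\<And>m. q (w (\<tau> m)) (p (x (\<tau> m)) (T (\<psi> m))) \<in> G (\<tau> m)"
      "\<And>m. p (x (\<tau> m)) (T (\<psi> m)) \<in> S - X closure_of V'" by blast
    obtain \<sigma> c' where \<sigma>: "strict_mono \<sigma>" "conv (\<lambda>n. p (x (\<tau> (\<sigma> n))) (T (\<psi> (\<sigma> n)))) c'"
      using pert[of "\<lambda>n. x (\<tau> n)", OF _ \<psi>(1)] x by auto
    have "conv (\<lambda>n. w (\<tau> (\<sigma> n))) c"
      using conv_subseq[OF conv_subseq[OF \<rho>(2) \<rho>'(1)] \<sigma>(1)] unfolding \<tau>_def .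
    from conv_q[OF this \<sigma>(2)]
    have "conv (\<lambda>n. q (w (\<tau> (\<sigma> n))) (p (x (\<tau> (\<sigma> n))) (T (\<psi> (\<sigma> n))))) (q c c')" .
    moreover have "q (w (\<tau> (\<sigma> n))) (p (x (\<tau> (\<sigma> n))) (T (\<psi> (\<sigma> n)))) \<in> G n" for n
    proof -
      have "n \<le> \<tau> (\<sigma> n)" using \<tau> seq_suble[OF \<sigma>(1)] order_trans by blast
      then show ?thesis using \<psi>(2) anti by blast
    qed
    ultimately have "q c c' \<in> (\<Inter>n. G n)" using nested_limit[OF G(1)] by blast
    then have "c' = c" using q_eq_e[OF conv_in[OF \<rho>(2)] conv_in[OF \<sigma>(2)]] G(2) by blast
    then obtain n where "p (x (\<tau> (\<sigma> n))) (T (\<psi> (\<sigma> n))) \<in> V'"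
      using conv_eventually[OF \<sigma>(2) V'(1)] V'(2) by blast
    moreover have "V' \<subseteq> X closure_of V'" using V'(1) by (simp add: closure_of_subset openin_subset)
    ultimately show False using \<psi>(3)[of "\<sigma> n"] by blast
  qed
  then show "\<exists>r c. strict_mono r \<and> c \<in> M \<and> conv (\<lambda>n. x (r n)) c"
    using \<rho>(1) conv_closedin[OF _ M(1)] xM by blast
qed

end

section \<open>Countable cs*-networks\<close>

text \<open>An enumerated cs*-network at \<open>e\<close>; regularity allows its members to be
  replaced by their closures, as \<open>rectified_cs_net_exists\<close> does.\<close>

locale rectified_cs_net = rectified +
  fixes N :: "nat \<Rightarrow> 'a set"
  assumes closed_N: "\<And>i. closedin X (N i)"
    and e_in_N: "\<And>i. e \<in> N i"
    and net: "\<And>U s. \<lbrakk>openin X U; e \<in> U; conv s e; \<And>n. s n \<in> S\<rbrakk>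
      \<Longrightarrow> \<exists>i. N i \<subseteq> U \<and> infinite {n. s n \<in> N i}"
begin

lemma N_sub: "N i \<subseteq> S"
  using closed_N by (rule closedin_subset)

lemma net_subseq:
  assumes "openin X U" "e \<in> U" "conv s e" "\<And>n. s n \<in> S"
  obtains i and r :: "nat \<Rightarrow> nat" where "N i \<subseteq> U" "strict_mono r" "\<forall>n. s (r n) \<in> N i"
proof -
  obtain i where i: "N i \<subseteq> U" "infinite {n. s n \<in> N i}" using net[OF assms] by blast
  from frequently_subseq[OF i(2)] obtain r :: "nat \<Rightarrow> nat"
    where "strict_mono r" "\<And>n. s (r n) \<in> N i" by blast
  then show thesis using that i(1) by blast
qed

definition small :: "'a set \<Rightarrow> nat \<Rightarrow> 'a set" where
  "small U m = (\<Union>i\<in>{i. i \<le> m \<and> N i \<subseteq> U}. N i)"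

lemma small_sub: "small U m \<subseteq> U" and small_in: "x \<in> small U m \<Longrightarrow> x \<in> S"
  using N_sub unfolding small_def by blast+

lemma smallI: "\<lbrakk>x \<in> N i; N i \<subseteq> U; i \<le> m\<rbrakk> \<Longrightarrow> x \<in> small U m"
  unfolding small_def by blast

text \<open>Both \<open>q (w l) c\<close> and \<open>q c (w n)\<close> converge to \<open>e\<close>, so \<open>w n\<close> is reached from one fixed
  \<open>w l\<close> by two steps inside members of the network, without reference to the limit \<open>c\<close>.\<close>

lemma conv_capture:
  assumes w: "conv w c" "\<And>n. w n \<in> S" and U: "openin X U" "e \<in> U"
  obtains l i j v where "N i \<subseteq> U" "N j \<subseteq> U" "v \<in> N i"
    "infinite {n. \<exists>u\<in>N j. w n = p (p (w l) v) u}"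
proof -
  have c: "c \<in> S" using w(1) by (rule conv_in)
  have "conv (\<lambda>n. q c (w n)) e" using w(1) by (rule conv_q_self)
  then obtain j where j: "N j \<subseteq> U" "infinite {n. q c (w n) \<in> N j}"
    using net[OF U, of "\<lambda>n. q c (w n)"] w c by auto
  have "conv (\<lambda>l. q (w l) c) e" using conv_q[OF w(1) conv_const[OF c]] c by simp
  then obtain i where i: "N i \<subseteq> U" "infinite {n. q (w n) c \<in> N i}"
    using net[OF U, of "\<lambda>n. q (w n) c"] w c by auto
  obtain l where l: "q (w l) c \<in> N i" using i(2) not_finite_existsD by auto
  have "w n = p (p (w l) (q (w l) c)) (q c (w n))" for n using w(2) c by simp
  then have "{n. q c (w n) \<in> N j} \<subseteq> {n. \<exists>u\<in>N j. w n = p (p (w l) (q (w l) c)) u}" by blast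
  then have "infinite {n. \<exists>u\<in>N j. w n = p (p (w l) (q (w l) c)) u}"
    using j(2) finite_subset by blast
  then show thesis using that i(1) j(1) l by blast
qed

section \<open>Fans of sequences in the non-metrizable case\<close>

text \<open>The shape comes from solving \<open>p (q x y) t = p (p (p (q x' y') s) v) u\<close> for
  \<open>t\<close>; the right side is what \<open>conv_capture\<close> gives for a perturbed point
  in terms of an earlier one.\<close>

definition words5 :: "'a set \<Rightarrow> 'a set" where
  "words5 A = {q (q x y) (p (p (p (q x' y') s) v) u) | x y x' y' s v u.
     x \<in> A \<and> y \<in> A \<and> x' \<in> A \<and> y' \<in> A \<and> s \<in> A \<and> v \<in> A \<and> u \<in> A}"

lemma words5I: "\<lbrakk>x \<in> A; y \<in> A; x' \<in> A; y' \<in> A; s \<in> A; v \<in> A; u \<in> A\<rbrakk>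
    \<Longrightarrow> q (q x y) (p (p (p (q x' y') s) v) u) \<in> words5 A"
  unfolding words5_def by blast

lemma words5_nbhd:
  assumes "openin X U" "e \<in> U"
  obtains V where "openin X V" "e \<in> V" "words5 V \<subseteq> U"
proof -
  obtain V1 where V1: "openin X V1" "e \<in> V1" "V1 \<subseteq> U"
    "\<forall>x\<in>V1. \<forall>y\<in>V1. p x y \<in> U \<and> q x y \<in> U"
    by (rule nbhd_pq[OF assms])
  obtain V2 where V2: "openin X V2" "e \<in> V2" "V2 \<subseteq> V1"
    "\<forall>x\<in>V2. \<forall>y\<in>V2. p x y \<in> V1 \<and> q x y \<in> V1"
    by (rule nbhd_pq[OF V1(1,2)])
  obtain V3 where V3: "openin X V3" "e \<in> V3" "V3 \<subseteq> V2"
    "\<forall>x\<in>V3. \<forall>y\<in>V3. p x y \<in> V2 \<and> q x y \<in> V2"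
    by (rule nbhd_pq[OF V2(1,2)])
  obtain V4 where V4: "openin X V4" "e \<in> V4" "V4 \<subseteq> V3"
    "\<forall>x\<in>V4. \<forall>y\<in>V4. p x y \<in> V3 \<and> q x y \<in> V3"
    by (rule nbhd_pq[OF V3(1,2)])
  obtain V5 where V5: "openin X V5" "e \<in> V5" "V5 \<subseteq> V4"
    "\<forall>x\<in>V5. \<forall>y\<in>V5. p x y \<in> V4 \<and> q x y \<in> V4"
    by (rule nbhd_pq[OF V4(1,2)])
  have "q (q x y) (p (p (p (q x' y') s) v) u) \<in> U"
    if "x \<in> V5" "y \<in> V5" "x' \<in> V5" "y' \<in> V5" "s \<in> V5" "v \<in> V5" "u \<in> V5" for x y x' y' s v u
  proof -
    have sub: "V5 \<subseteq> V4" "V5 \<subseteq> V3" "V5 \<subseteq> V2" using V5(3) V4(3) V3(3) by blast+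
    have "q x' y' \<in> V4" "s \<in> V4" using V5(4) that sub by blast+
    then have "p (q x' y') s \<in> V3" "v \<in> V3" using V4(4) that sub by blast+
    then have "p (p (q x' y') s) v \<in> V2" "u \<in> V2" using V3(4) that sub by blast+
    then have "p (p (p (q x' y') s) v) u \<in> V1" using V2(4) by blast
    moreover have "q x y \<in> V4" using V5(4) that by blast
    then have "q x y \<in> V1" using V4(3) V3(3) V2(3) by blast
    ultimately show ?thesis using V1(4) by blast
  qed
  then have "words5 V5 \<subseteq> U" unfolding words5_def by blast
  then show thesis using that V5 by blast
qed

lemma words5_mono: "A \<subseteq> B \<Longrightarrow> words5 A \<subseteq> words5 B"
  unfolding words5_def by blast

text \<open>There are only countably many finite index sets, so the barriers built from them by
  \<open>F\<close> can be enumerated.\<close>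

lemma metrizable_if_net_barriers:
  fixes F :: "'a set \<Rightarrow> 'a set"
  assumes "\<And>U. \<lbrakk>openin X U; e \<in> U\<rbrakk> \<Longrightarrow>
      \<exists>J. finite J \<and> F (\<Union>(N ` J)) \<subseteq> U \<and> barrier S (F (\<Union>(N ` J)))"
  shows "metrizable_space X"
proof -
  define \<J> where "\<J> = {J. finite J \<and> barrier S (F (\<Union>(N ` J)))}"
  have "countable \<J>"
    using countable_Collect_finite by (rule countable_subset[rotated]) (auto simp: \<J>_def)
  moreover have "\<J> \<noteq> {}" using assms[OF openin_topspace e_in] unfolding \<J>_def by blast
  ultimately have J: "range (from_nat_into \<J>) = \<J>" by (rule range_from_nat_into[rotated])
  show ?thesis
  proof (rule metrizable_if_barriers[where B = "\<lambda>n. F (\<Union>(N ` from_nat_into \<J> n))"])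
    show "barrier S (F (\<Union>(N ` from_nat_into \<J> n)))" for n
      using from_nat_into[OF \<open>\<J> \<noteq> {}\<close>, of n] unfolding \<J>_def by blast
    fix U assume "openin X U" "e \<in> U"
    then obtain K where "K \<in> \<J>" "F (\<Union>(N ` K)) \<subseteq> U" using assms unfolding \<J>_def by blast
    then show "\<exists>n. F (\<Union>(N ` from_nat_into \<J> n)) \<subseteq> U" using J by (metis imageE)
  qed
qed

lemma fan_exists:
  assumes "\<not> metrizable_space X"
  obtains U \<sigma> where "openin X U" "e \<in> U" "\<And>m n. \<sigma> m n \<in> S - words5 (small U m)"
    "\<And>m. conv (\<sigma> m) e" "\<And>m. \<exists>k. N k \<subseteq> U \<and> (\<forall>n. \<sigma> m n \<in> N k)"
proof -
  obtain U where U: "openin X U" "e \<in> U"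
    "\<And>J. \<lbrakk>finite J; words5 (\<Union>(N ` J)) \<subseteq> U\<rbrakk> \<Longrightarrow> \<not> barrier S (words5 (\<Union>(N ` J)))"
    using assms metrizable_if_net_barriers[of words5] by blast
  obtain V where V: "openin X V" "e \<in> V" "words5 V \<subseteq> U" by (rule words5_nbhd[OF U(1,2)])
  have "\<forall>m. \<exists>s. (\<forall>n. s n \<in> S - words5 (small V m)) \<and> conv s e \<and> (\<exists>k. N k \<subseteq> V \<and> (\<forall>n. s n \<in> N k))"
  proof
    fix m
    have "words5 (small V m) \<subseteq> U" using words5_mono[OF small_sub] V(3) by blast
    then have "\<not> barrier S (words5 (small V m))"
      using U(3)[of "{i. i \<le> m \<and> N i \<subseteq> V}"] unfolding small_def by simp
    then obtain s where s: "\<And>n. s n \<in> S - words5 (small V m)" "conv s e"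
      unfolding barrier_def by blast
    then have sS: "\<And>n. s n \<in> S" by blast
    obtain k and r :: "nat \<Rightarrow> nat"
      where r: "N k \<subseteq> V" "strict_mono r" "\<forall>n. s (r n) \<in> N k"
      by (rule net_subseq[OF V(1,2) s(2) sS])
    show "\<exists>s. (\<forall>n. s n \<in> S - words5 (small V m)) \<and> conv s e \<and> (\<exists>k. N k \<subseteq> V \<and> (\<forall>n. s n \<in> N k))"
      using s(1) conv_subseq[OF s(2) r(2)] r by (intro exI[of _ "\<lambda>n. s (r n)"]) blast
  qed
  then obtain \<sigma> where "\<forall>m. (\<forall>n. \<sigma> m n \<in> S - words5 (small V m)) \<and> conv (\<sigma> m) e \<and>
      (\<exists>k. N k \<subseteq> V \<and> (\<forall>n. \<sigma> m n \<in> N k))"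
    unfolding choice_iff by blast
  \<comment> \<open>The neighbourhood handed on is the smaller one, \<open>V\<close>.\<close>
  then show thesis using that[OF V(1,2), of \<sigma>] by blast
qed

text \<open>If these points \<open>w n\<close> converged, infinitely many of them would be reached
  from one \<open>w l\<close> by two steps inside fixed members of the network. As soon as
  \<open>k n\<close> exceeds the finitely many indices involved, \<open>\<sigma> (k n) (f n)\<close>
  becomes a word that line \<open>k n\<close> of the fan avoids.\<close>

lemma fan_no_diagonal_limit:
  fixes k f :: "nat \<Rightarrow> nat"
  assumes U: "openin X U" "e \<in> U" and \<sigma>: "\<And>m n. \<sigma> m n \<in> S - words5 (small U m)"
    "\<And>m. \<exists>k. N k \<subseteq> U \<and> (\<forall>n. \<sigma> m n \<in> N k)"
    and a: "N a \<subseteq> U" and xy: "\<And>n. x n \<in> N a" "\<And>n. y n \<in> N a" and k: "strict_mono k"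
  shows "\<not> conv (\<lambda>n. p (q (x n) (y n)) (\<sigma> (k n) (f n))) c"
proof
  define w where "w n = p (q (x n) (y n)) (\<sigma> (k n) (f n))" for n
  assume "conv (\<lambda>n. p (q (x n) (y n)) (\<sigma> (k n) (f n))) c"
  then have w: "conv w c" unfolding w_def .
  have xyS: "q (x n) (y n) \<in> S" for n using xy N_sub by (meson q_in subsetD)
  have \<sigma>S: "\<sigma> m n \<in> S" for m n using \<sigma>(1) by blast
  have wS: "w n \<in> S" for n unfolding w_def using xyS \<sigma>S by simp
  obtain l i j v where l: "N i \<subseteq> U" "N j \<subseteq> U" "v \<in> N i"
    "infinite {n. \<exists>u\<in>N j. w n = p (p (w l) v) u}" by (rule conv_capture[OF w wS U])
  obtain b where b: "N b \<subseteq> U" "\<sigma> (k l) (f l) \<in> N b" using \<sigma>(2) by blast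
  define m where "m = Max {a, b, i, j}"
  obtain n where n: "m \<le> n" "\<exists>u\<in>N j. w n = p (p (w l) v) u" by (rule infinite_ge[OF l(4)])
  then obtain u where u: "u \<in> N j" "w n = p (p (w l) v) u" by blast
  have le: "a \<le> k n" "b \<le> k n" "i \<le> k n" "j \<le> k n"
    using n(1) seq_suble[OF k, of n] by (auto simp: m_def)
  have "q (q (x n) (y n)) (w n) \<in> words5 (small U (k n))"
    unfolding u(2) w_def[of l]
    by (intro words5I smallI[OF xy(1) a le(1)] smallI[OF xy(2) a le(1)] smallI[OF b(2,1) le(2)]
        smallI[OF l(3,1) le(3)] smallI[OF u(1) l(2) le(4)])
  moreover have "q (q (x n) (y n)) (w n) = \<sigma> (k n) (f n)"
    unfolding w_def using xyS \<sigma>S by simp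
  ultimately show False using \<sigma>(1)[of "k n" "f n"] by simp
qed

text \<open>Take \<open>a\<close> with \<open>N a\<close> capturing a subsequence of
  \<open>z\<close>. If every \<open>k\<close> capturing that subsequence infinitely often failed,
  each would carry perturbed points \<open>w k m\<close> without a convergent subsequence. Together
  they form a closed set apart from \<open>e\<close>, although they come arbitrarily near
  \<open>e\<close>.\<close>

lemma pseudocompact_net:
  assumes "\<not> metrizable_space X"
  obtains T where "\<And>k. conv (T k) e" "\<And>k n. T k n \<in> S"
    "\<And>z. \<lbrakk>conv z e; \<And>n. z n \<in> S\<rbrakk> \<Longrightarrow>
      \<exists>k a. pseudocompact_along (N k \<inter> N a) (T k) \<and> infinite {n. z n \<in> N k \<inter> N a}"
proof -
  obtain U \<sigma> where U: "openin X U" "e \<in> U"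
    and \<sigma>: "\<And>m n. \<sigma> m n \<in> S - words5 (small U m)" "\<And>m. conv (\<sigma> m) e"
      "\<And>m. \<exists>k. N k \<subseteq> U \<and> (\<forall>n. \<sigma> m n \<in> N k)"
    using fan_exists[OF assms] by metis
  have \<sigma>S: "\<sigma> m n \<in> S" for m n using \<sigma>(1) by blast
  have "\<exists>k a. pseudocompact_along (N k \<inter> N a) (\<sigma> k) \<and> infinite {n. z n \<in> N k \<inter> N a}"
    if z: "conv z e" "\<And>n. z n \<in> S" for z
  proof (rule ccontr)
    assume none: "\<nexists>k a. pseudocompact_along (N k \<inter> N a) (\<sigma> k) \<and> infinite {n. z n \<in> N k \<inter> N a}"
    obtain a and r :: "nat \<Rightarrow> nat"
      where r: "N a \<subseteq> U" "strict_mono r" "\<forall>n. z (r n) \<in> N a"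
      by (rule net_subseq[OF U z])
    define I where "I = {k. infinite {n. z (r n) \<in> N k}}"
    define bad where "bad k x y \<phi> \<longleftrightarrow>
        (\<forall>n. x n \<in> N k \<inter> N a) \<and> (\<forall>n. y n \<in> N k \<inter> N a) \<and> strict_mono \<phi> \<and>
        (\<forall>r c. strict_mono r \<longrightarrow> \<not> conv (\<lambda>n. p (q (x (r n)) (y (r n))) (\<sigma> k (\<phi> (r n)))) c)"
      for k x y and \<phi> :: "nat \<Rightarrow> nat"
    have "\<exists>x y \<phi>. bad k x y \<phi>" if "k \<in> I" for k
    proof -
      have "r ` {n. z (r n) \<in> N k} \<subseteq> {n. z n \<in> N k \<inter> N a}" using r(3) by blast
      moreover have "infinite (r ` {n. z (r n) \<in> N k})"
        using \<open>k \<in> I\<close> finite_imageD[OF _ strict_mono_imp_inj_on[OF r(2)]] unfolding I_def by blast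
      ultimately have "infinite {n. z n \<in> N k \<inter> N a}" using finite_subset by blast
      then have "\<not> pseudocompact_along (N k \<inter> N a) (\<sigma> k)" using none by blast
      then show ?thesis unfolding pseudocompact_along_def bad_def by simp
    qed
    then obtain x y \<phi> where "\<And>k. k \<in> I \<Longrightarrow> bad k (x k) (y k) (\<phi> k)" by metis
    then have xy: "\<And>k n. k \<in> I \<Longrightarrow> x k n \<in> N k \<inter> N a" "\<And>k n. k \<in> I \<Longrightarrow> y k n \<in> N k \<inter> N a"
        "\<And>k. k \<in> I \<Longrightarrow> strict_mono (\<phi> k)"
      and no_sub: "\<And>k (r :: nat \<Rightarrow> nat) c. \<lbrakk>k \<in> I; strict_mono r\<rbrakk> \<Longrightarrow>
        \<not> conv (\<lambda>n. p (q (x k (r n)) (y k (r n))) (\<sigma> k (\<phi> k (r n)))) c"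
      unfolding bad_def by simp_all
    define w where "w k m = p (q (x k m) (y k m)) (\<sigma> k (\<phi> k m))" for k m
    \<comment> \<open>\<open>e\<close> is taken out so that \<open>S - C\<close> is a neighbourhood
      of it once \<open>C\<close> is closed.\<close>
    define C where "C = {w k m | k m. k \<in> I} - {e}"
    have wS: "w k m \<in> S" if "k \<in> I" for k m
      using xy(1,2)[OF that, of m] N_sub[of a] \<sigma>S unfolding w_def by (intro p_in q_in) blast+
    have "closedin X C"
    proof (rule closedin_if_conv)
      show "C \<subseteq> S" using wS unfolding C_def by blast
      fix u c assume u: "\<And>n. u n \<in> C" "conv u c"
      have rep: "c \<in> C" if "strict_mono \<rho>" "\<And>n. u (\<rho> n) = d" for \<rho> :: "nat \<Rightarrow> nat" and d
      proof -
        have "conv (\<lambda>n. d) c" using conv_subseq[OF u(2) that(1)] that(2) by simp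
        moreover have "conv (\<lambda>n. d) d" using u(1) that(2) \<open>C \<subseteq> S\<close> by (metis conv_const subsetD)
        ultimately have "c = d" by (rule conv_unique)
        then show ?thesis using u(1) that(2) by metis
      qed
      have "\<forall>n. \<exists>k m. u n = w k m \<and> k \<in> I" using u(1) unfolding C_def by blast
      then obtain \<kappa> \<mu> where \<kappa>: "\<And>n. u n = w (\<kappa> n) (\<mu> n)" "\<And>n. \<kappa> n \<in> I" by metis
      show "c \<in> C"
      \<comment> \<open>A sequence in \<open>C\<close> has a subsequence that is constant, or runs
        along one line \<open>w k\<close>, or runs across the lines. The last two kinds cannot
        converge, by the choice of \<open>w k\<close> and by
        \<open>fan_no_diagonal_limit\<close>.\<close>
      proof (cases \<kappa> rule: nat_seq_const_or_strict_mono)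
        case (const k \<rho>)
        show ?thesis
        proof (cases "\<lambda>n. \<mu> (\<rho> n)" rule: nat_seq_const_or_strict_mono)
          case c2: (const m \<rho>')
          have "strict_mono (\<lambda>n. \<rho> (\<rho>' n))"
            using strict_mono_o[OF const(1) c2(1)] by (simp add: o_def)
          then show ?thesis
            by (rule rep[of _ "w k m"])
              (simp add: \<kappa>(1) const(2) c2(2))
        next
          case (strict \<rho>')
          have "conv (\<lambda>n. u (\<rho> (\<rho>' n))) c"
            by (rule conv_subseq[OF conv_subseq[OF u(2) const(1)] strict(1)])
          then have "conv (\<lambda>n. w k (\<mu> (\<rho> (\<rho>' n)))) c" by (simp add: \<kappa>(1) const(2))
          moreover have "k \<in> I" using \<kappa>(2) const(2) by metis
          ultimately show ?thesis using no_sub[OF _ strict(2)] unfolding w_def by blast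
        qed
      next
        case (strict \<rho>)
        have "conv (\<lambda>n. u (\<rho> n)) c" by (rule conv_subseq[OF u(2) strict(1)])
        moreover have "\<not> conv (\<lambda>n. u (\<rho> n)) c"
          unfolding \<kappa>(1) w_def using xy(1,2) \<kappa>(2)
          by (intro fan_no_diagonal_limit[OF U \<sigma>(1,3) r(1) _ _ strict(2)]) blast+
        ultimately show ?thesis by blast
      qed
    qed
    then have "openin X (S - C)" "e \<in> S - C"
      by (auto simp: C_def openin_diff)
    then obtain V where V: "openin X V" "e \<in> V" "V \<subseteq> S - C" "\<forall>x\<in>V. \<forall>y\<in>V. p x y \<in> S - C \<and> q x y \<in> S - C"
      using nbhd_pq by metis
    obtain V' where V': "openin X V'" "e \<in> V'" "V' \<subseteq> V" "\<forall>x\<in>V'. \<forall>y\<in>V'. p x y \<in> V \<and> q x y \<in> V"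
      by (rule nbhd_pq[OF V(1,2)])
    obtain k where k: "N k \<subseteq> V'" "k \<in> I"
      using net[OF V'(1,2) conv_subseq[OF z(1) r(2)]] z(2) unfolding I_def by blast
    obtain m0 where m0: "\<forall>n\<ge>m0. \<sigma> k n \<in> V'" using conv_eventually[OF \<sigma>(2) V'(1,2)] by blast
    \<comment> \<open>The letters \<open>x k m\<close>, \<open>y k m\<close> and
      \<open>\<sigma> k (\<phi> k m)\<close> all lie near \<open>e\<close>, so \<open>w k m\<close>
      avoids \<open>C\<close> and can only be \<open>e\<close>; then \<open>w k\<close> would
      converge.\<close>
    have "w k m = e" if "m0 \<le> m" for m
    proof -
      have "m0 \<le> \<phi> k m" using that seq_suble[OF xy(3)[OF k(2)], of m] by simp
      then have "\<sigma> k (\<phi> k m) \<in> V" using m0 V'(3) by blast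
      moreover have "x k m \<in> V'" "y k m \<in> V'" using xy(1,2)[OF k(2), of m] k(1) by blast+
      ultimately have "w k m \<in> S - C" unfolding w_def using V(4) V'(4) by blast
      then show ?thesis using k(2) unfolding C_def by blast
    qed
    then have "conv (\<lambda>n. w k (n + m0)) e" by simp
    then show False
      using no_sub[OF k(2), of "\<lambda>n. n + m0"] unfolding w_def by (simp add: strict_mono_def)
  qed
  then show thesis using that[of \<sigma>] \<sigma>(2) \<sigma>S by blast
qed

section \<open>Countably many barriers and the point \<open>e\<close> as a countable
  intersection\<close>

text \<open>The expression \<open>p (p w v) u\<close> of \<open>conv_capture\<close> for a perturbed
  point \<open>w = p z t\<close>.\<close>

definition words4 :: "'a set \<Rightarrow> 'a set" where
  "words4 A = {p (p (p a b) c) d | a b c d. a \<in> A \<and> b \<in> A \<and> c \<in> A \<and> d \<in> A}"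

lemma words4I: "\<lbrakk>a \<in> A; b \<in> A; c \<in> A; d \<in> A\<rbrakk> \<Longrightarrow> p (p (p a b) c) d \<in> words4 A"
  unfolding words4_def by blast

lemma words4_mono: "A \<subseteq> B \<Longrightarrow> words4 A \<subseteq> words4 B"
  unfolding words4_def by blast

lemma words4_sub: "A \<subseteq> S \<Longrightarrow> words4 A \<subseteq> S"
  unfolding words4_def by (auto simp: subset_iff)

lemma words4_nbhd:
  assumes "openin X U" "e \<in> U"
  obtains V where "openin X V" "e \<in> V" "words4 V \<subseteq> U"
proof -
  obtain V1 where V1: "openin X V1" "e \<in> V1" "V1 \<subseteq> U" "\<forall>x\<in>V1. \<forall>y\<in>V1. p x y \<in> U \<and> q x y \<in> U"
    by (rule nbhd_pq[OF assms])
  obtain V2 where V2: "openin X V2" "e \<in> V2" "V2 \<subseteq> V1" "\<forall>x\<in>V2. \<forall>y\<in>V2. p x y \<in> V1 \<and> q x y \<in> V1"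
    by (rule nbhd_pq[OF V1(1,2)])
  obtain V3 where V3: "openin X V3" "e \<in> V3" "V3 \<subseteq> V2" "\<forall>x\<in>V3. \<forall>y\<in>V3. p x y \<in> V2 \<and> q x y \<in> V2"
    by (rule nbhd_pq[OF V2(1,2)])
  have "p (p (p a b) c) d \<in> U" if "a \<in> V3" "b \<in> V3" "c \<in> V3" "d \<in> V3" for a b c d
  proof -
    have "p a b \<in> V2" "c \<in> V2" using V3(3,4) that by blast+
    then have "p (p a b) c \<in> V1" "d \<in> V1" using V2(3,4) V3(3) that by blast+
    then show ?thesis using V1(4) by blast
  qed
  then have "words4 V3 \<subseteq> U" unfolding words4_def by blast
  then show thesis using that V3(1,2) by blast
qed

text \<open>Otherwise each \<open>m\<close> has a point \<open>z m\<close> of \<open>Q\<close>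
  outside the closed set \<open>E m\<close> of words in the first members. A small perturbation by
  \<open>T\<close> keeps it outside and makes the points subconverge, so \<open>conv_capture\<close>
  writes a late one as a word that \<open>E\<close> contains.\<close>

lemma pseudocompact_along_barrier:
  assumes MS: "M \<subseteq> S" and M: "pseudocompact_along M T" and T: "conv T e" "\<And>n. T n \<in> S"
    and U: "openin X U" "e \<in> U"
  shows "\<exists>J. finite J \<and> X closure_of words4 (\<Union>(N ` J)) \<subseteq> U \<and>
    barrier {q x y | x y. x \<in> M \<and> y \<in> M} (X closure_of words4 (\<Union>(N ` J)))"
proof (rule ccontr)
  assume none: "\<not> ?thesis"
  define Q where "Q = {q x y | x y. x \<in> M \<and> y \<in> M}"
  have none': "\<not> barrier Q (X closure_of words4 (\<Union>(N ` J)))"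
    if "finite J" "X closure_of words4 (\<Union>(N ` J)) \<subseteq> U" for J
    using none that unfolding Q_def by blast
  obtain V0 where V0: "openin X V0" "e \<in> V0" "X closure_of V0 \<subseteq> U" by (rule regular_nbhd[OF U])
  obtain V where V: "openin X V" "e \<in> V" "words4 V \<subseteq> V0" by (rule words4_nbhd[OF V0(1,2)])
  \<comment> \<open>The closure makes the complement open, so that it survives perturbation;
    \<open>V0\<close> leaves room for it inside \<open>U\<close>.\<close>
  define E where "E m = X closure_of words4 (small V m)" for m
  have E_closed: "closedin X (E m)" for m unfolding E_def by (rule closedin_closure_of)
  have E_sub: "words4 (small V m) \<subseteq> E m" for m
    unfolding E_def using words4_sub[of "small V m"] small_in by (intro closure_of_subset) blast
  have QS: "Q \<subseteq> S" unfolding Q_def using MS by (auto intro!: q_in)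
  have "\<exists>x. x \<in> Q \<and> x \<notin> E m \<and> (\<exists>k. N k \<subseteq> V \<and> x \<in> N k)" for m
  proof -
    have "words4 (small V m) \<subseteq> V0" using words4_mono[OF small_sub] V(3) by blast
    then have "E m \<subseteq> U" unfolding E_def using closure_of_mono V0(3) by blast
    then have "\<not> barrier Q (E m)"
      using none'[of "{i. i \<le> m \<and> N i \<subseteq> V}"] unfolding E_def small_def by simp
    then obtain s where s: "\<And>n. s n \<in> Q - E m" "conv s e" unfolding barrier_def by blast
    then have sS: "\<And>n. s n \<in> S" using QS by blast
    obtain k and r :: "nat \<Rightarrow> nat" where "N k \<subseteq> V" "strict_mono r" "\<forall>n. s (r n) \<in> N k"
      by (rule net_subseq[OF V(1,2) s(2) sS])
    then show ?thesis using s(1)[of "r 0"] by blast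
  qed
  then obtain z where z: "\<And>m. z m \<in> Q" "\<And>m. z m \<notin> E m" "\<And>m. \<exists>k. N k \<subseteq> V \<and> z m \<in> N k" by metis
  have zS: "z m \<in> S" for m using z(1) QS by blast
  \<comment> \<open>Thinning \<open>T\<close> into a single member \<open>N h\<close> makes its
    terms admissible letters with one bounded index.\<close>
  obtain h and \<tau> :: "nat \<Rightarrow> nat" where \<tau>: "N h \<subseteq> V" "strict_mono \<tau>" "\<forall>n. T (\<tau> n) \<in> N h"
    by (rule net_subseq[OF V(1,2) T])
  have "\<forall>m. \<exists>k. \<forall>j\<ge>k. p (z m) (T (\<tau> j)) \<in> S - E m"
  proof
    fix m
    have "conv (\<lambda>j. p (z m) (T (\<tau> j))) (z m)"
      using conv_p_const[OF zS conv_subseq[OF T(1) \<tau>(2)]] .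
    then show "\<exists>k. \<forall>j\<ge>k. p (z m) (T (\<tau> j)) \<in> S - E m"
      by (rule conv_eventually) (use zS z(2) E_closed in auto)
  qed
  from strict_mono_choice[OF this] obtain \<phi>
    where \<phi>: "strict_mono \<phi>" "\<And>m. p (z m) (T (\<tau> (\<phi> m))) \<in> S - E m" by blast
  define w where "w m = p (z m) (T (\<tau> (\<phi> m)))" for m
  have "\<forall>m. \<exists>x y. z m = q x y \<and> x \<in> M \<and> y \<in> M" using z(1) unfolding Q_def by blast
  then obtain x y where xy: "\<And>m. z m = q (x m) (y m)" "\<And>m. x m \<in> M" "\<And>m. y m \<in> M" by metis
  have \<tau>\<phi>: "strict_mono (\<lambda>m. \<tau> (\<phi> m))"
    using strict_mono_o[OF \<tau>(2) \<phi>(1)] by (simp add: o_def)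
  obtain \<rho> c where \<rho>: "strict_mono \<rho>" "conv (\<lambda>n. p (q (x (\<rho> n)) (y (\<rho> n))) (T (\<tau> (\<phi> (\<rho> n))))) c"
    by (rule pseudocompact_alongD[OF M xy(2,3) \<tau>\<phi>])
  then have w: "conv (\<lambda>n. w (\<rho> n)) c" unfolding w_def xy(1) by blast
  have wS: "w m \<in> S" for m unfolding w_def using \<phi>(2) by blast
  obtain l i j v where l: "N i \<subseteq> V" "N j \<subseteq> V" "v \<in> N i"
    "infinite {n. \<exists>u\<in>N j. w (\<rho> n) = p (p (w (\<rho> l)) v) u}" by (rule conv_capture[OF w wS V(1,2)])
  obtain k where k: "N k \<subseteq> V" "z (\<rho> l) \<in> N k" using z(3) by blast
  define m where "m = Max {h, i, j, k}"
  obtain n where n: "m \<le> n" "\<exists>u\<in>N j. w (\<rho> n) = p (p (w (\<rho> l)) v) u" by (rule infinite_ge[OF l(4)])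
  then obtain u where u: "u \<in> N j" "w (\<rho> n) = p (p (w (\<rho> l)) v) u" by blast
  have le: "h \<le> \<rho> n" "i \<le> \<rho> n" "j \<le> \<rho> n" "k \<le> \<rho> n"
    using n(1) seq_suble[OF \<rho>(1), of n] by (auto simp: m_def)
  have "w (\<rho> n) \<in> words4 (small V (\<rho> n))"
    unfolding u(2) w_def[of "\<rho> l"]
    by (intro words4I smallI[OF k(2,1) le(4)] smallI[OF spec[OF \<tau>(3)] \<tau>(1) le(1)]
        smallI[OF l(3,1) le(2)] smallI[OF u(1) l(2) le(3)])
  then show False using E_sub \<phi>(2)[of "\<rho> n"] unfolding w_def by blast
qed

text \<open>The barriers for \<open>Q\<close> made from finite parts of the network are countable in
  number and lie below every neighbourhood of \<open>e\<close>. By \<open>barriers_imp_nbhds\<close>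
  each contains the trace on \<open>M\<close> of a neighbourhood, and by \<open>t1\<close> these
  traces share only \<open>e\<close>.\<close>

lemma pseudocompact_along_Gdelta:
  assumes M: "closedin X M" "e \<in> M" "pseudocompact_along M T" and T: "conv T e" "\<And>n. T n \<in> S"
  shows "\<exists>H :: nat \<Rightarrow> 'a set. (\<forall>n. openin X (H n) \<and> e \<in> H n) \<and> (\<Inter>n. H n) \<inter> M \<subseteq> {e}"
proof -
  have MS: "M \<subseteq> S" using M(1) by (rule closedin_subset)
  define Q where "Q = {q x y | x y. x \<in> M \<and> y \<in> M}"
  define F where "F J = X closure_of words4 (\<Union>(N ` J))" for J
  define \<J> where "\<J> = {J. finite J \<and> barrier Q (F J)}"
  have bar: "\<exists>J\<in>\<J>. F J \<subseteq> U" if "openin X U" "e \<in> U" for U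
    using pseudocompact_along_barrier[OF MS M(3) T that] unfolding \<J>_def F_def Q_def by blast
  have "countable \<J>"
    using countable_Collect_finite by (rule countable_subset[rotated]) (auto simp: \<J>_def)
  moreover have "\<J> \<noteq> {}" using bar[OF openin_topspace e_in] by blast
  ultimately have J: "range (from_nat_into \<J>) = \<J>" by (rule range_from_nat_into[rotated])
  define B where "B n = F (from_nat_into \<J> n)" for n
  have barB: "barrier Q (B n)" for n
    using from_nat_into[OF \<open>\<J> \<noteq> {}\<close>, of n] unfolding \<J>_def B_def by blast
  have baseB: "\<exists>n. B n \<subseteq> U" if "openin X U" "e \<in> U" for U
    using bar[OF that] J unfolding B_def by (metis imageE)
  have QS: "Q \<subseteq> S" unfolding Q_def using MS by (auto intro!: q_in)
  have "\<exists>G. openin X G \<and> e \<in> G \<and> G \<inter> M \<subseteq> B n" for n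
  proof -
    obtain G where "openin X G" "e \<in> G" "G \<inter> M \<subseteq> B n"
      by (rule barriers_imp_nbhds[OF M(1,2) QS _ barB baseB, of n]) (auto simp: Q_def)
    then show ?thesis by blast
  qed
  then obtain H where H: "\<And>n. openin X (H n)" "\<And>n. e \<in> H n" "\<And>n. H n \<inter> M \<subseteq> B n" by metis
  have "x = e" if x: "x \<in> (\<Inter>n. H n) \<inter> M" for x
  proof (rule ccontr)
    assume "x \<noteq> e"
    then have "openin X (S - {x})" "e \<in> S - {x}"
      using t1 x MS by (auto simp: t1_space_openin_delete_alt)
    then obtain n where "B n \<subseteq> S - {x}" using baseB by blast
    then show False using H(3)[of n] x by blast
  qed
  then show ?thesis using H(1,2) by blast
qed

text \<open>The neighbourhoods belonging to all good \<open>L i\<close> refine to one nested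
  sequence with intersection \<open>W\<close>, which meets each good \<open>L i\<close> only in
  \<open>e\<close>. As good sets capture every sequence tending to \<open>e\<close>, no sequence in
  \<open>W - {e}\<close> does so; hence \<open>W - {e}\<close> is closed and can be cut
  away.\<close>

lemma seq_compact_net:
  assumes "\<not> metrizable_space X"
  obtains M G where "\<And>i :: nat. seq_compactin (M i)"
    "\<And>z. \<lbrakk>conv z e; \<And>n. z n \<in> S\<rbrakk> \<Longrightarrow> \<exists>i. infinite {n. z n \<in> M i}"
    "nested G" "(\<Inter>n. G n) = {e}"
proof -
  obtain T where T: "\<And>k. conv (T k) e" "\<And>k n. T k n \<in> S"
    "\<And>z. \<lbrakk>conv z e; \<And>n. z n \<in> S\<rbrakk> \<Longrightarrow>
      \<exists>k a. pseudocompact_along (N k \<inter> N a) (T k) \<and> infinite {n. z n \<in> N k \<inter> N a}"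
    using pseudocompact_net[OF assms] by metis
  define L where "L i = N (fst (prod_decode i)) \<inter> N (snd (prod_decode i))" for i
  define good where "good i \<longleftrightarrow> pseudocompact_along (L i) (T (fst (prod_decode i)))" for i
  have L: "closedin X (L i)" "e \<in> L i" for i
    unfolding L_def using closed_N e_in_N by (simp_all add: closedin_Int)
  have good: "\<exists>i. good i \<and> infinite {n. z n \<in> L i}" if z: "conv z e" "\<And>n. z n \<in> S" for z
  proof -
    obtain k a where "pseudocompact_along (N k \<inter> N a) (T k)" "infinite {n. z n \<in> N k \<inter> N a}"
      using T(3)[OF z] by blast
    then show ?thesis unfolding good_def L_def by (intro exI[of _ "prod_encode (k, a)"]) simp
  qed
  have "\<exists>H :: nat \<Rightarrow> 'a set. (\<forall>n. openin X (H n) \<and> e \<in> H n) \<and> (good i \<longrightarrow> (\<Inter>n. H n) \<inter> L i \<subseteq> {e})" for i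
  proof (cases "good i")
    case True
    then show ?thesis using pseudocompact_along_Gdelta[OF L _ T(1,2)] unfolding good_def by blast
  next
    case False
    then show ?thesis by (intro exI[of _ "\<lambda>_. S"]) simp
  qed
  then obtain H :: "nat \<Rightarrow> nat \<Rightarrow> 'a set" where H: "\<And>i n. openin X (H i n)" "\<And>i n. e \<in> H i n"
    "\<And>i. good i \<Longrightarrow> (\<Inter>n. H i n) \<inter> L i \<subseteq> {e}" by metis
  obtain G where G: "nested G" "\<And>n. G n \<subseteq> H (fst (prod_decode n)) (snd (prod_decode n))"
    by (rule nested_refinement[of "\<lambda>n. H (fst (prod_decode n)) (snd (prod_decode n))"])
      (use H in auto)
  define W where "W = (\<Inter>n. G n)"
  have WL: "W \<inter> L i \<subseteq> {e}" if "good i" for i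
  proof -
    have "W \<subseteq> H i n" for n using G(2)[of "prod_encode (i, n)"] unfolding W_def by auto
    then show ?thesis using H(3)[OF that] by blast
  qed
  have GS: "G n \<subseteq> S" for n using G(1) openin_subset unfolding nested_def by blast
  have "closedin X (W - {e})"
  proof (rule closedin_if_conv)
    show "W - {e} \<subseteq> S" using GS unfolding W_def by blast
    fix s x assume s: "\<And>n. s n \<in> W - {e}" "conv s x"
    have "x \<in> W" unfolding W_def
      using nested_limit[OF G(1) s(2)] s(1) unfolding W_def by blast
    moreover have "x \<noteq> e"
    proof
      assume "x = e"
      then obtain i where "good i" "infinite {n. s n \<in> L i}"
        using good[of s] s GS unfolding W_def by blast
      moreover have "{n. s n \<in> L i} = {}" using WL[OF \<open>good i\<close>] s(1) by blast
      ultimately show False by simp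
    qed
    ultimately show "x \<in> W - {e}" by blast
  qed
  then have O: "openin X (S - (W - {e}))" "e \<in> S - (W - {e})" by auto
  obtain G' where G': "nested G'" "\<And>n. G' n \<subseteq> G n \<inter> (S - (W - {e}))"
    by (rule nested_refinement[of "\<lambda>n. G n \<inter> (S - (W - {e}))"])
      (use O G(1) in \<open>auto simp: nested_def\<close>)
  have "e \<in> G' n" for n using G'(1) unfolding nested_def by blast
  then have G'e: "(\<Inter>n. G' n) = {e}" using G'(2) unfolding W_def by blast
  \<comment> \<open>The default \<open>{e}\<close> is sequentially compact, and capturing relies on
    good indices alone.\<close>
  have "seq_compactin (if good i then L i else {e})" for i
    using pseudocompact_along_imp_seq_compactin[OF L _ T(1,2) G'(1) G'e] seq_compactin_sing
    unfolding good_def by auto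
  moreover have "\<exists>i. infinite {n. z n \<in> (if good i then L i else {e})}"
    if "conv z e" "\<And>n. z n \<in> S" for z
    using good[OF that] by (metis (mono_tags, lifting) Collect_cong)
  ultimately show thesis using that[of "\<lambda>i. if good i then L i else {e}" G'] G'(1) G'e by blast
qed

end

section \<open>The component of \<open>e\<close> and the product decomposition\<close>

context rectified begin

lemma continuous_map_p:
  "\<lbrakk>continuous_map Z X f; continuous_map Z X g\<rbrakk> \<Longrightarrow> continuous_map Z X (\<lambda>z. p (f z) (g z))"
  using continuous_map_compose[OF continuous_map_pairedI cont_p, of Z f g] by (simp add: o_def)

lemma continuous_map_q:
  "\<lbrakk>continuous_map Z X f; continuous_map Z X g\<rbrakk> \<Longrightarrow> continuous_map Z X (\<lambda>z. q (f z) (g z))"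
  using continuous_map_compose[OF continuous_map_pairedI cont_q, of Z f g] by (simp add: o_def)

abbreviation component where "component x \<equiv> connected_component_of_set X x"

lemma component_subset: "component x \<subseteq> S"
  by (rule connected_component_of_subset_topspace)

lemma component_self: "x \<in> S \<Longrightarrow> x \<in> component x"
  by (simp add: connected_component_of_refl)

lemma p_component: "\<lbrakk>x \<in> S; y \<in> component e\<rbrakk> \<Longrightarrow> p x y \<in> component x"
proof -
  assume x: "x \<in> S" and y: "y \<in> component e"
  have "connectedin X ((\<lambda>y. p x y) ` component e)"
    using x by (intro connectedin_continuous_map_image[of X] continuous_map_p
        connectedin_connected_component_of) (simp_all add: continuous_map_const)
  moreover have "x \<in> (\<lambda>y. p x y) ` component e"
    using component_self[OF e_in] x by (intro image_eqI[of _ _ e]) simp_all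
  ultimately show ?thesis using y by (meson connected_component_of_maximal imageI subsetD)
qed

lemma q_component: "\<lbrakk>x \<in> S; y \<in> component x\<rbrakk> \<Longrightarrow> q x y \<in> component e"
proof -
  assume x: "x \<in> S" and y: "y \<in> component x"
  have "connectedin X ((\<lambda>y. q x y) ` component x)"
    using x by (intro connectedin_continuous_map_image[of X] continuous_map_q
        connectedin_connected_component_of) (simp_all add: continuous_map_const)
  moreover have "e \<in> (\<lambda>y. q x y) ` component x"
    using component_self[OF x] x by (intro image_eqI[of _ _ x]) simp_all
  ultimately show ?thesis using y by (meson connected_component_of_maximal imageI subsetD)
qed

text \<open>Translation carries the component of \<open>e\<close> onto that of any \<open>z\<close>.
  Components are open by local connectedness, so the chosen representative \<open>d x\<close> is
  locally constant, and \<open>x\<close> corresponds to the pair of \<open>q (d x) x\<close> and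
  \<open>d x\<close>.\<close>

lemma homeomorphic_component_times_discrete:
  assumes lc: "locally_connected_space X"
  obtains D :: "'a set" where
    "X homeomorphic_space prod_topology (subtopology X (component e)) (discrete_topology D)"
proof -
  define d where "d x = (SOME z. z \<in> component x)" for x
  define D where "D = d ` S"
  have d: "d x \<in> component x" if "x \<in> S" for x
    unfolding d_def using component_self[OF that] by (rule someI)
  have dS: "d x \<in> S" if "x \<in> S" for x
    using subsetD[OF component_subset d[OF that]] .
  have comp_eq: "component x = component y" if "y \<in> component x" for x y
    using that connected_component_of_equiv[of X x y] by simp
  \<comment> \<open>Choice is applied to the same set for all points of a component, so it returns
    the same point.\<close>
  have d_eq: "d y = d x" if "y \<in> component x" for x y
    unfolding d_def comp_eq[OF that] by simp
  have comp_d: "component (d x) = component x" if "x \<in> S" for x using comp_eq[OF d[OF that]] by simp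
  have dd: "d z = z" if "z \<in> D" for z
  proof -
    obtain x where "x \<in> S" "z = d x" using \<open>z \<in> D\<close> unfolding D_def by blast
    then show ?thesis using d_eq[OF d] by simp
  qed
  have DS: "D \<subseteq> S" unfolding D_def using dS by blast
  have d_cont: "continuous_map X (discrete_topology D) d"
    unfolding continuous_map_def topspace_discrete_topology openin_discrete_topology
  proof (intro conjI allI impI)
    show "d \<in> S \<rightarrow> D" unfolding D_def by blast
    fix U assume "U \<subseteq> D"
    show "openin X {x \<in> S. d x \<in> U}"
    proof (subst openin_subopen, intro ballI)
      fix x assume x: "x \<in> {x \<in> S. d x \<in> U}"
      have "component x \<subseteq> {x \<in> S. d x \<in> U}"
      proof
        fix y assume y: "y \<in> component x"
        then show "y \<in> {x \<in> S. d x \<in> U}"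
          using subsetD[OF component_subset y] d_eq[OF y] x by simp
      qed
      then show "\<exists>T. openin X T \<and> x \<in> T \<and> T \<subseteq> {x \<in> S. d x \<in> U}"
        using openin_connected_component_of_locally_connected_space[OF lc, of x] component_self[of x] x
        by (intro exI[of _ "component x"]) simp
    qed
  qed
  have id_D: "continuous_map (discrete_topology D) X id" using DS by auto
  have d_cont': "continuous_map X X d"
    using continuous_map_compose[OF d_cont id_D] by simp
  let ?Y = "subtopology X (component e)"
  have "homeomorphic_maps X (prod_topology ?Y (discrete_topology D))
      (\<lambda>x. (q (d x) x, d x)) (\<lambda>(y, z). p z y)"
    unfolding homeomorphic_maps_def
  proof (intro conjI ballI)
    have "q (d x) x \<in> component e" if "x \<in> S" for x
      using q_component[OF dS[OF that]] comp_d[OF that] component_self[OF that] by simp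
    then have "continuous_map X ?Y (\<lambda>x. q (d x) x)"
      using d_cont' continuous_map_q[OF d_cont' continuous_map_id]
      by (auto simp: continuous_map_in_subtopology)
    then show "continuous_map X (prod_topology ?Y (discrete_topology D)) (\<lambda>x. (q (d x) x, d x))"
      using d_cont by (rule continuous_map_pairedI)
    have "continuous_map (prod_topology ?Y (discrete_topology D)) X fst"
      by (rule continuous_map_into_fulltopology[OF continuous_map_fst])
    moreover have "continuous_map (prod_topology ?Y (discrete_topology D)) X snd"
      using continuous_map_compose[OF continuous_map_snd id_D] by simp
    ultimately have "continuous_map (prod_topology ?Y (discrete_topology D)) X (\<lambda>z. p (snd z) (fst z))"
      by (intro continuous_map_p)
    then show "continuous_map (prod_topology ?Y (discrete_topology D)) X (\<lambda>(y, z). p z y)"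
      by (simp add: case_prod_unfold)
    show "(case (q (d x) x, d x) of (y, z) \<Rightarrow> p z y) = x" if "x \<in> S" for x
      using that dS by simp
    fix yz assume "yz \<in> topspace (prod_topology ?Y (discrete_topology D))"
    then obtain y z where yz: "yz = (y, z)" "y \<in> S" "y \<in> component e" "z \<in> D" by auto
    then have z: "z \<in> S" using DS by blast
    have "d (p z y) = z" using d_eq[OF p_component[OF z yz(3)]] dd[OF yz(4)] by simp
    then show "(q (d (case yz of (y, z) \<Rightarrow> p z y)) (case yz of (y, z) \<Rightarrow> p z y),
        d (case yz of (y, z) \<Rightarrow> p z y)) = yz"
      using yz z by simp
  qed
  then have "X homeomorphic_space prod_topology ?Y (discrete_topology D)"
    unfolding homeomorphic_space_def by (intro exI)
  then show thesis by (rule that)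
qed

text \<open>The sets \<open>C n\<close> are sequentially compact and absorb translates of the
  \<open>M i\<close>, so they capture each sequence converging to a point of their union
  \<open>H\<close>. This makes \<open>H\<close> clopen, hence a superset of the component, and lets
  the \<open>C n\<close> determine closedness there.\<close>

lemma sk_omega_component:
  fixes M :: "nat \<Rightarrow> 'a set"
  assumes M: "\<And>i. seq_compactin (M i)"
    and net: "\<And>z. \<lbrakk>conv z e; \<And>n. z n \<in> S\<rbrakk> \<Longrightarrow> \<exists>i. infinite {n. z n \<in> M i}"
    and G: "nested G" "(\<Inter>n. G n) = {e}"
  shows "sk_omega_space (subtopology X (component e))"
proof -
  define C where "C = rec_nat {e} (\<lambda>n K. K \<union> M n \<union> {p x y | x y. x \<in> K \<and> y \<in> K})"
  have C0: "C 0 = {e}" and CSuc: "C (Suc n) = C n \<union> M n \<union> {p x y | x y. x \<in> C n \<and> y \<in> C n}" for n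
    by (simp_all add: C_def)
  have C: "seq_compactin (C n)" for n
    by (induction n) (simp_all add: C0 CSuc seq_compactin_sing seq_compactin_Un seq_compactin_p M)
  have CS: "C n \<subseteq> S" for n using C[of n] by (simp add: seq_compactin_def)
  have mono: "C m \<subseteq> C n" if "m \<le> n" for m n
    using that by (rule lift_Suc_mono_le[rotated]) (auto simp: CSuc)
  have p_C: "p x y \<in> C (Suc (max m (Suc i)))" if "x \<in> C m" "y \<in> M i" for x y m i
  proof -
    have "x \<in> C (max m (Suc i))" using that(1) mono[of m "max m (Suc i)"] by auto
    moreover have "y \<in> C (max m (Suc i))"
      using that(2) mono[of "Suc i" "max m (Suc i)"] by (auto simp: CSuc)
    ultimately show ?thesis unfolding CSuc by blast
  qed
  \<comment> \<open>Pull the sequence back to \<open>e\<close> by \<open>q x\<close>, catch it in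
    some \<open>M i\<close>, and return by \<open>p x\<close>; \<open>max m (Suc i)\<close> is a
    stage containing both \<open>x\<close> and \<open>M i\<close>.\<close>
  have capture: "\<exists>k. infinite {n. s n \<in> C k}"
    if s: "conv s x" "\<And>n. s n \<in> S" and x: "x \<in> C m" for s x m
  proof -
    have xS: "x \<in> S" using conv_in[OF s(1)] .
    have "\<exists>i. infinite {n. q x (s n) \<in> M i}"
      using net[OF conv_q_self[OF s(1)]] xS s(2) by simp
    then obtain i where i: "infinite {n. q x (s n) \<in> M i}" by blast
    have "{n. q x (s n) \<in> M i} \<subseteq> {n. s n \<in> C (Suc (max m (Suc i)))}"
    proof
      fix n assume "n \<in> {n. q x (s n) \<in> M i}"
      then have "p x (q x (s n)) \<in> C (Suc (max m (Suc i)))" using p_C[OF x] by blast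
      then show "n \<in> {n. s n \<in> C (Suc (max m (Suc i)))}" using xS s(2) by simp
    qed
    then show ?thesis using i finite_subset by blast
  qed
  define H where "H = (\<Union>n. C n)"
  have HS: "H \<subseteq> S" unfolding H_def using CS by blast
  have "openin X H"
  proof (rule openin_if_conv[OF HS])
    fix s x assume s: "\<And>n. s n \<in> S" "conv s x" "x \<in> H"
    then obtain m where "x \<in> C m" unfolding H_def by blast
    then obtain k where "infinite {n. s n \<in> C k}" using capture[OF s(2,1)] by blast
    then obtain n where "s n \<in> C k" using not_finite_existsD by auto
    then show "\<exists>n. s n \<in> H" unfolding H_def by blast
  qed
  moreover have "closedin X H"
  proof (rule closedin_if_conv[OF HS])
    fix s x assume s: "\<And>n. s n \<in> H" "conv s x"
    have sS: "s n \<in> S" for n using s(1) HS by blast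
    have xS: "x \<in> S" using conv_in[OF s(2)] .
    \<comment> \<open>For closedness the limit is reached from a term of the sequence:
      \<open>x = p (s n) (q (s n) x)\<close> with \<open>s n \<in> H\<close>.\<close>
    have "conv (\<lambda>n. q (s n) x) e" using conv_q[OF s(2) conv_const[OF xS]] xS by simp
    then obtain i where "infinite {n. q (s n) x \<in> M i}"
      using net[of "\<lambda>n. q (s n) x"] sS xS by auto
    then obtain n where n: "q (s n) x \<in> M i" using not_finite_existsD by auto
    obtain m where "s n \<in> C m" using s(1) unfolding H_def by blast
    from p_C[OF this n] show "x \<in> H" using sS xS unfolding H_def by auto
  qed
  ultimately have YH: "component e \<subseteq> H"
    using connectedin_clopen_cases[OF connectedin_connected_component_of[of X e]]
      component_self[OF e_in] C0 unfolding H_def disjnt_iff by blast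
  define Y where "Y = component e"
  have Y: "closedin X Y" unfolding Y_def by (rule closedin_connected_component_of)
  have YS: "Y \<subseteq> S" using Y by (rule closedin_subset)
  have closed_CY: "closedin X (C n \<inter> Y)" for n
    using seq_compactin_closedin[OF C] Y by (rule closedin_Int)
  have CY: "seq_compactin (C n \<inter> Y)" for n
    unfolding seq_compactin_def
  proof (intro conjI allI impI)
    show "C n \<inter> Y \<subseteq> S" using YS by blast
    fix s :: "nat \<Rightarrow> 'a" assume s: "\<forall>m. s m \<in> C n \<inter> Y"
    then have sC: "\<And>m. s m \<in> C n" by blast
    obtain r c where r: "strict_mono r" "c \<in> C n" "conv (\<lambda>m. s (r m)) c"
      by (rule seq_compactinD[OF C sC])
    have "c \<in> C n \<inter> Y" using conv_closedin[OF r(3) closed_CY] s by blast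
    then show "\<exists>r c. strict_mono r \<and> c \<in> C n \<inter> Y \<and> conv (\<lambda>m. s (r m)) c" using r by blast
  qed
  have YC: "Y = (\<Union>n. C n \<inter> Y)" using YH unfolding Y_def H_def by blast
  have "closedin (subtopology X Y) A"
    if A: "A \<subseteq> Y" "\<And>n. closedin (subtopology (subtopology X Y) (C n \<inter> Y)) (A \<inter> (C n \<inter> Y))" for A
  proof -
    have An: "closedin X (A \<inter> (C n \<inter> Y))" for n
      using A(2)[of n] closedin_trans_full[OF _ closed_CY]
      by (simp add: subtopology_subtopology Int_absorb1)
    have "closedin X A"
    proof (rule closedin_if_conv)
      show "A \<subseteq> S" using A(1) YS by blast
      fix s x assume s: "\<And>n. s n \<in> A" "conv s x"
      have sS: "s n \<in> S" for n using s(1) A(1) YS by blast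
      have "x \<in> Y" using conv_closedin[OF s(2) Y] s(1) A(1) by blast
      then obtain m where "x \<in> C m" using YC by blast
      then obtain k where "infinite {n. s n \<in> C k}" using capture[OF s(2) sS] by blast
      from frequently_subseq[OF this] obtain r :: "nat \<Rightarrow> nat"
        where r: "strict_mono r" "\<And>n. s (r n) \<in> C k" by blast
      have "s (r n) \<in> A \<inter> (C k \<inter> Y)" for n using s(1) r(2) A(1) by blast
      then show "x \<in> A" using conv_closedin[OF conv_subseq[OF s(2) r(1)] An] by blast
    qed
    then show ?thesis using Y A(1) by (simp add: closedin_closed_subtopology)
  qed
  moreover have "closedin (subtopology (subtopology X Y) K) (A \<inter> K)"
    if "closedin (subtopology X Y) A" for A K
    using that by (auto simp: closedin_subtopology)
  ultimately have closed_iff: "closedin (subtopology X Y) A \<longleftrightarrow>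
      (\<forall>K\<in>range (\<lambda>n. C n \<inter> Y). closedin (subtopology (subtopology X Y) K) (A \<inter> K))"
    if "A \<subseteq> Y" for A using that by blast
  have topY: "topspace (subtopology X Y) = Y" using YS by auto
  have "sk_omega_space (subtopology X Y)"
    unfolding sk_omega_space_def topY
  proof (intro conjI exI[of _ "range (\<lambda>n. C n \<inter> Y)"] ballI allI impI)
    show "regular_space (subtopology X Y)" using regular by (rule regular_space_subtopology)
    show "t1_space (subtopology X Y)" using t1 by (rule t1_space_subtopology)
    show "countable (range (\<lambda>n. C n \<inter> Y))" by simp
    show "\<Union> (range (\<lambda>n. C n \<inter> Y)) = Y" using YC by blast
    fix K assume "K \<in> range (\<lambda>n. C n \<inter> Y)"
    then obtain n where K: "K = C n \<inter> Y" by blast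
    show "compactin (subtopology X Y) K"
      using seq_compactin_imp_compact_metrizable(2)[OF CY G] by (simp add: K compactin_subtopology)
    show "metrizable_space (subtopology (subtopology X Y) K)"
      using seq_compactin_imp_compact_metrizable(1)[OF CY G]
      by (simp add: K subtopology_subtopology Int_absorb1)
  qed (rule closed_iff)
  then show ?thesis unfolding Y_def .
qed

end

section \<open>From the topological hypotheses to operations and network\<close>

text \<open>The second coordinates of \<open>h\<close> and its inverse give \<open>p0\<close> and
  \<open>q0\<close> with \<open>p0 x e = x\<close>, but \<open>p0 e\<close> may differ from the
  identity; composing with \<open>q0 e\<close> and \<open>p0 e\<close> corrects this.\<close>

lemma rectified_if_rectifiable:
  assumes "regular_space X" "t1_space X" "sequential_space X" "rectifiable_space X"
  obtains e p q where "rectified X e p q"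
proof -
  let ?P = "prod_topology X X" and ?S = "topspace X"
  obtain e h where e: "e \<in> ?S" and h: "homeomorphic_map ?P ?P h"
    and he: "\<And>x. x \<in> ?S \<Longrightarrow> h (x, e) = (x, x)"
    and hx: "\<And>x. x \<in> ?S \<Longrightarrow> h ` ({x} \<times> ?S) \<subseteq> {x} \<times> ?S"
    using assms(4) unfolding rectifiable_space_def by blast
  obtain k where k: "continuous_map ?P ?P h" "continuous_map ?P ?P k"
    "\<And>z. z \<in> topspace ?P \<Longrightarrow> k (h z) = z" "\<And>z. z \<in> topspace ?P \<Longrightarrow> h (k z) = z"
    using h unfolding homeomorphic_map_maps homeomorphic_maps_def by blast
  define p0 where "p0 x y = snd (h (x, y))" for x y
  define q0 where "q0 x y = snd (k (x, y))" for x y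
  have hp: "h (x, y) = (x, p0 x y)" "p0 x y \<in> ?S" if "x \<in> ?S" "y \<in> ?S" for x y
  proof -
    have "h (x, y) \<in> {x} \<times> ?S" using hx[OF that(1)] that(2) by blast
    then show "h (x, y) = (x, p0 x y)" "p0 x y \<in> ?S" by (auto simp: p0_def)
  qed
  \<comment> \<open>Fibre preservation passes to the inverse: \<open>h\<close> keeps the first
    coordinate of \<open>k (x, y)\<close>, and it maps that point to \<open>(x, y)\<close>.\<close>
  have kq: "k (x, y) = (x, q0 x y)" "q0 x y \<in> ?S" if xy: "x \<in> ?S" "y \<in> ?S" for x y
  proof -
    have "k (x, y) \<in> ?S \<times> ?S"
      using continuous_map_image_subset_topspace[OF k(2)] xy by force
    then obtain a b where ab: "k (x, y) = (a, b)" "a \<in> ?S" "b \<in> ?S" by blast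
    then have "h (a, b) = (x, y)" using k(4)[of "(x, y)"] xy by simp
    then have "a = x" using hp(1)[OF ab(2,3)] by simp
    then show "k (x, y) = (x, q0 x y)" "q0 x y \<in> ?S" using ab by (simp_all add: q0_def)
  qed
  have pq0: "p0 x (q0 x y) = y" "q0 x (p0 x y) = y" if "x \<in> ?S" "y \<in> ?S" for x y
    using k(3,4)[of "(x, y)"] that hp kq by auto
  have p0e: "p0 x e = x" if "x \<in> ?S" for x using he[OF that] by (simp add: p0_def)
  have q0ee: "q0 e e = e" using pq0(2)[OF e e] p0e[OF e] by simp
  have "continuous_map ?P X (snd \<circ> h)" "continuous_map ?P X (snd \<circ> k)"
    using continuous_map_compose[OF k(1) continuous_map_snd]
      continuous_map_compose[OF k(2) continuous_map_snd] by blast+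
  then have c: "continuous_map ?P X (\<lambda>z. p0 (f z) (g z))" "continuous_map ?P X (\<lambda>z. q0 (f z) (g z))"
    if "continuous_map ?P X f" "continuous_map ?P X g" for f g
    using continuous_map_compose[OF continuous_map_pairedI[OF that], of X]
    unfolding p0_def q0_def by (auto simp: o_def)
  have ce: "continuous_map ?P X (\<lambda>z. e)" using e by simp
  have "rectified X e (\<lambda>x y. p0 x (q0 e y)) (\<lambda>x y. p0 e (q0 x y))"
  proof
    show "continuous_map ?P X (\<lambda>(x, y). p0 x (q0 e y))"
      unfolding case_prod_unfold by (intro c ce continuous_map_fst continuous_map_snd)
    show "continuous_map ?P X (\<lambda>(x, y). p0 e (q0 x y))"
      unfolding case_prod_unfold by (intro c ce continuous_map_fst continuous_map_snd)
  qed (use assms e pq0 hp kq p0e q0ee in auto)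
  then show thesis by (rule that)
qed

text \<open>Shrinking \<open>U\<close> to a \<open>V\<close> with closure in \<open>U\<close> lets
  the closures of the members inside \<open>V\<close> do the work. Only members through
  \<open>e\<close> are kept, and the constant sequence at \<open>e\<close> shows that there are
  some.\<close>

lemma (in rectified) rectified_cs_net_exists:
  assumes "countable_cs_star_character X"
  obtains N where "rectified_cs_net X e p q N"
proof -
  obtain \<N> where \<N>: "countable \<N>" "cs_star_network_at X e \<N>"
    using assms e_in unfolding countable_cs_star_character_def by blast
  have sub: "M \<subseteq> S" if "M \<in> \<N>" for M using that \<N>(2) unfolding cs_star_network_at_def by blast
  have net: "\<exists>M\<in>\<N>. e \<in> M \<and> M \<subseteq> U \<and> infinite {n. s n \<in> M}"
    if "openin X U" "e \<in> U" "conv s e" "\<And>n. s n \<in> S" for U s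
  proof -
    have "U \<subseteq> S \<and> (\<exists>W. openin X W \<and> e \<in> W \<and> W \<subseteq> U) \<and> range s \<subseteq> S \<and> conv s e"
      using that openin_subset by blast
    then show ?thesis using \<N>(2) unfolding cs_star_network_at_def by blast
  qed
  define \<M> where "\<M> = {M \<in> \<N>. e \<in> M}"
  have "\<M> \<noteq> {}" using net[of S "\<lambda>_. e"] unfolding \<M>_def by auto
  moreover have "countable \<M>" using \<N>(1) unfolding \<M>_def by simp
  ultimately have M: "range (from_nat_into \<M>) = \<M>" by (rule range_from_nat_into)
  have "rectified_cs_net X e p q (\<lambda>i. X closure_of from_nat_into \<M> i)"
  proof
    fix i
    show "closedin X (X closure_of from_nat_into \<M> i)" by (rule closedin_closure_of)
    have "from_nat_into \<M> i \<in> \<M>" using \<open>\<M> \<noteq> {}\<close> by (rule from_nat_into)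
    then have "e \<in> from_nat_into \<M> i" "from_nat_into \<M> i \<subseteq> S" using sub unfolding \<M>_def by blast+
    then show "e \<in> X closure_of from_nat_into \<M> i" using closure_of_subset by blast
  next
    fix U s assume U: "openin X U" "e \<in> U" and s: "conv s e" "\<And>n. s n \<in> S"
    obtain V where V: "openin X V" "e \<in> V" "X closure_of V \<subseteq> U" by (rule regular_nbhd[OF U])
    obtain L where L: "L \<in> \<N>" "e \<in> L" "L \<subseteq> V" "infinite {n. s n \<in> L}" using net[OF V(1,2) s] by blast
    then have "L \<in> \<M>" unfolding \<M>_def by blast
    then have "L \<in> range (from_nat_into \<M>)" using M by simp
    then obtain i where i: "L = from_nat_into \<M> i" by blast
    have "X closure_of L \<subseteq> U" using closure_of_mono[OF L(3)] V(3) by blast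
    moreover have "L \<subseteq> X closure_of L" using sub[OF L(1)] by (rule closure_of_subset)
    then have "{n. s n \<in> L} \<subseteq> {n. s n \<in> X closure_of L}" by blast
    then have "infinite {n. s n \<in> X closure_of L}" using L(4) finite_subset by blast
    ultimately show "\<exists>i. X closure_of from_nat_into \<M> i \<subseteq> U \<and>
        infinite {n. s n \<in> X closure_of from_nat_into \<M> i}"
      unfolding i by blast
  qed
  then show thesis by (rule that)
qed

theorem corollary1p4:
  fixes X :: "'a topology"
  assumes "regular_space X" and "t1_space X"
    and "locally_connected_space X"
    and "\<not> metrizable_space X"
    and "sequential_space X"
    and "rectifiable_space X"
    and "countable_cs_star_character X"
  shows "\<exists>(H :: 'a topology) (D :: 'a set).
           connected_space H \<and> sk_omega_space H \<and>
           X homeomorphic_space prod_topology H (discrete_topology D)"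
proof -
  obtain e p q where "rectified X e p q"
    by (rule rectified_if_rectifiable[OF assms(1,2,5,6)])
  then interpret rectified X e p q .
  obtain N where "rectified_cs_net X e p q N" by (rule rectified_cs_net_exists[OF assms(7)])
  then interpret rectified_cs_net X e p q N .
  obtain M G where MG: "\<And>i :: nat. seq_compactin (M i)"
    "\<And>z. \<lbrakk>conv z e; \<And>n. z n \<in> S\<rbrakk> \<Longrightarrow> \<exists>i. infinite {n. z n \<in> M i}"
    "nested G" "(\<Inter>n. G n) = {e}"
    using seq_compact_net[OF assms(4)] by metis
  have "sk_omega_space (subtopology X (component e))" by (rule sk_omega_component[OF MG])
  moreover have "connected_space (subtopology X (component e))"
    using connectedin_connected_component_of[of X e] by (simp add: connectedin_def)
  moreover obtain D :: "'a set" where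
    "X homeomorphic_space prod_topology (subtopology X (component e)) (discrete_topology D)"
    by (rule homeomorphic_component_times_discrete[OF assms(3)])
  ultimately show ?thesis by blast
qed

end
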